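(* Let $n\ge 4$ and $0\le t\le n-4$, let $c\in\mathbb Z$, and let $a_1,\dots,a_p,b_1,\dots,b_q$ be integers. The following are equivalent. (i) There is a long Bourbaki sequence $$0\to\bigoplus_{i=1}^pS(-a_i)\to\bigoplus_{i=1}^qS(-b_i)\to E_{t+1}\to I(c)\to 0\quad(\text{exact}),$$ where $I\subset S$ is a graded ideal. (ii) There are $\beta_1,\dots,\beta_q\in K_{t+1}\setminus E_{t+2}$ and $\varphi\in\mathbf A$ such that: (a) $\varphi:K_{t+1}\to S(-n)$ defines a homomorphism of degree $n+c$, and $\operatorname{Ker}\varphi=\langle\beta_1,\dots,\beta_q\rangle+E_{t+2}$; and (b) with $p=q+1-\binom{n-1}{t}$, there is a commutative diagram with exact rows and exact columns $$\begin{array}{ccccccc} & & 0 & & 0 & & \\ & & \downarrow & & \downarrow & & \\ 0&\to&\operatorname{Ker}\operatorname{Res}(\beta)&\to&\operatorname{Ker}\beta&\to&0\\ & & \downarrow & & \downarrow & & \\ 0&\to&\bigoplus_{i=1}^pS(-a_i)&\to&\bigoplus_{i=1}^qS(-b_i)& & \\ & & {\scriptstyle \operatorname{Res}(\beta)}\downarrow & & {\scriptstyle\beta}\downarrow & & \\ 0&\to&\langle\beta_1,\dots,\beta_q\rangle\cap E_{t+2}&\to&\langle\beta_1,\dots,\beta_q\rangle& & \\ & & \downarrow & & \downarrow & & \\ & & 0 & & 0 & & \end{array}$$ where $\beta(g_i)=\beta_i$ for all $i$, with $g_1,\dots,g_q$ the free basis of $\bigoplus_{i=1}^qS(-b_i)$,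 and $\operatorname{Res}(-)$ denotes restriction of maps. In this case, $I=\varphi(K_{t+1})(-c)$.
   Context: $K$ is a field, $S=K[x_1,\dots,x_n]$ has the standard grading, $\mathfrak m=(x_1,\dots,x_n)$. All modules and ideals are graded; $M(d)_i=M_{d+i}$. $(K_\bullet,\partial_\bullet)$ is the graded Koszul complex of $x_1,\dots,x_n$ over $S$, $K_j\cong S(-j)^{\binom nj}$, with basis elements $e_J$ for $J\subset[n]=\{1,\dots,n\}$, $|J|=j$; $e_J^*$ denotes the dual basis of the dual of $K_j$, where $(-)^*=\operatorname{Hom}_S(-,S(-n))$. $E_j=\operatorname{Im}(\partial_j)\subset K_{j-1}$ is the $j$-th syzygy module of $S/\mathfrak m$ over $S$. $\langle\cdots\rangle$ denotes the $S$-submodule generated. A homomorphism $\varphi$ of degree $n+c$ into $S(-n)$ is the same as a degree-$0$ homomorphism into $S(c)$, and its image is viewed in $S(c)$. For disjoint $J,L\subset[n]$, $\sigma(J,L)=(-1)^i$ with $i=\#\{(j,k)\in J\times L\mid j>k\}$. The submodule $\mathbf A\subset K_{t+1}^*$ is $$\mathbf A=\Big\langle\sum_{j=1}^{n-t}(-1)^{j+1}\sigma\big(L\setminus\{i_j\},([n]\setminus L)\cup\{i_j\}\big)\,x_{i_j}\,e^*_{([n]\setminus L)\cup\{i_j\}}\ \Big|\ L=\{i_1<\dots<i_{n-t}\}\subset[n]\Big\rangle .$$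
   Formalization: In (i) it is additionally required that each free basis element g_i of ⊕S(-b_i) has nonzero image in E_{t+1}; without this the equivalence fails, e.g. t=0, c=0, p=q=1, a_1=b_1, with S(-a_1) → S(-a_1) the identity, the zero map to E_1=m, and m → m the identity. *)

theory Defs
  imports
    "HOL.Modules"
    "HOL-Library.Poly_Mapping"
    "HOL-Library.Function_Algebras"
    "HOL-Library.Cardinality"
begin

section \<open>The standard graded polynomial ring\<close>

text \<open>
  The finite linearly ordered type \<open>'n\<close> plays the role of \<open>[n] = {1 < \<dots> < n}\<close>, so that
  \<open>n = CARD('n)\<close>.  A polynomial is a finitely supported function from exponent vectors to
  coefficients; the multiplication of \<open>HOL-Library.Poly_Mapping\<close> is convolution.
\<close>

type_synonym ('n, 'k) mpoly = "('n \<Rightarrow>\<^sub>0 nat) \<Rightarrow>\<^sub>0 'k"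

definition var :: "'n \<Rightarrow> ('n, 'k::field) mpoly" where
  "var i = Poly_Mapping.single (Poly_Mapping.single i 1) 1"

definition mon_deg :: "('n::finite \<Rightarrow>\<^sub>0 nat) \<Rightarrow> nat" where
  "mon_deg m = (\<Sum>i\<in>UNIV. Poly_Mapping.lookup m i)"

text \<open>\<open>S\<^sub>d\<close>, for an arbitrary integer \<open>d\<close>; it contains \<open>0\<close>, and is \<open>{0}\<close> for \<open>d < 0\<close>.\<close>

definition homog :: "int \<Rightarrow> ('n::finite, 'k::field) mpoly set" where
  "homog d = {f. \<forall>m\<in>Poly_Mapping.keys f. int (mon_deg m) = d}"


section \<open>Graded modules\<close>

text \<open>
  A graded module is a carrier inside an ambient additive group \<open>'m\<close>, whose addition it inherits,
  together with a scalar action and the family of its homogeneous parts.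
\<close>

record ('s, 'm) gmod =
  act :: "'s \<Rightarrow> 'm \<Rightarrow> 'm"
  carr :: "'m set"
  hpart :: "int \<Rightarrow> 'm set"

definition ring_gmod :: "(('n::finite, 'k::field) mpoly, ('n, 'k) mpoly) gmod" where
  "ring_gmod = \<lparr>act = (*), carr = UNIV, hpart = homog\<rparr>"

text \<open>The shift \<open>M(d)\<close>, with \<open>M(d)\<^sub>i = M\<^bsub>d+i\<^esub>\<close>.\<close>

definition shift :: "int \<Rightarrow> ('s, 'm) gmod \<Rightarrow> ('s, 'm) gmod" where
  "shift d M = \<lparr>act = act M, carr = carr M, hpart = (\<lambda>i. hpart M (d + i))\<rparr>"

text \<open>The submodule \<open>N\<close> of \<open>M\<close> with the grading induced from \<open>M\<close>.\<close>

definition gsub :: "('s, 'm) gmod \<Rightarrow> 'm set \<Rightarrow> ('s, 'm) gmod" where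
  "gsub M N = \<lparr>act = act M, carr = N, hpart = (\<lambda>i. N \<inter> hpart M i)\<rparr>"

text \<open>Pointwise action on families of ring elements; it is also used for \<open>S\<close>-valued functionals.\<close>

definition smult :: "'s::comm_ring_1 \<Rightarrow> ('x \<Rightarrow> 's) \<Rightarrow> ('x \<Rightarrow> 's)" where
  "smult r v = (\<lambda>x. r * v x)"

lemma module_smult: "module (smult :: 's::comm_ring_1 \<Rightarrow> ('x \<Rightarrow> 's) \<Rightarrow> ('x \<Rightarrow> 's))"
  by unfold_locales (auto simp: smult_def fun_eq_iff algebra_simps)

lemma module_times: "module ((*) :: 's::comm_ring_1 \<Rightarrow> 's \<Rightarrow> 's)"
  by unfold_locales (auto simp: algebra_simps)

text \<open>The direct sum of the modules \<open>S(-w x)\<close> over \<open>x \<in> X\<close>: families that vanish outside \<open>X\<close>.\<close>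

definition free_gmod ::
  "'x set \<Rightarrow> ('x \<Rightarrow> int) \<Rightarrow> (('n::finite, 'k::field) mpoly, 'x \<Rightarrow> ('n, 'k) mpoly) gmod" where
  "free_gmod X w =
     \<lparr>act = smult,
      carr = {v. \<forall>x. x \<notin> X \<longrightarrow> v x = 0},
      hpart = (\<lambda>i. {v. (\<forall>x. x \<notin> X \<longrightarrow> v x = 0) \<and>
                       (\<forall>x\<in>X. v x \<in> hpart (shift (- w x) ring_gmod) i)})\<rparr>"

definition basis :: "'x \<Rightarrow> ('x \<Rightarrow> 's::comm_ring_1)" where
  "basis x = (\<lambda>y. if y = x then 1 else 0)"

text \<open>Homogeneous homomorphisms of degree \<open>d\<close>.  Only the values on the carrier matter.\<close>

definition ghom :: "int \<Rightarrow> ('s, 'a::ab_group_add) gmod \<Rightarrow> ('s, 'b::ab_group_add) gmod \<Rightarrow> ('a \<Rightarrow> 'b) \<Rightarrow> bool" where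
  "ghom d M N f \<longleftrightarrow>
     f ` carr M \<subseteq> carr N \<and>
     (\<forall>u\<in>carr M. \<forall>v\<in>carr M. f (u + v) = f u + f v) \<and>
     (\<forall>r. \<forall>u\<in>carr M. f (act M r u) = act N r (f u)) \<and>
     (\<forall>i. \<forall>u\<in>hpart M i. f u \<in> hpart N (i + d))"

definition gker :: "('s, 'a) gmod \<Rightarrow> ('a \<Rightarrow> 'b::zero) \<Rightarrow> 'a set" where
  "gker M f = {u \<in> carr M. f u = 0}"

text \<open>Exactness of \<open>0 \<rightarrow> A \<rightarrow> B\<close>, of \<open>0 \<rightarrow> A \<rightarrow> B \<rightarrow> 0\<close>, of \<open>0 \<rightarrow> A \<rightarrow> B \<rightarrow> C \<rightarrow> 0\<close>
  and of \<open>0 \<rightarrow> A \<rightarrow> B \<rightarrow> C \<rightarrow> D \<rightarrow> 0\<close>, all maps being of degree 0.\<close>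

definition gmono :: "('s, 'a::ab_group_add) gmod \<Rightarrow> ('a \<Rightarrow> 'b) \<Rightarrow> ('s, 'b::ab_group_add) gmod \<Rightarrow> bool" where
  "gmono A f B \<longleftrightarrow> ghom 0 A B f \<and> gker A f = {0}"

definition giso :: "('s, 'a::ab_group_add) gmod \<Rightarrow> ('a \<Rightarrow> 'b) \<Rightarrow> ('s, 'b::ab_group_add) gmod \<Rightarrow> bool" where
  "giso A f B \<longleftrightarrow> gmono A f B \<and> f ` carr A = carr B"

definition short_exact ::
  "('s, 'a::ab_group_add) gmod \<Rightarrow> ('a \<Rightarrow> 'b) \<Rightarrow> ('s, 'b::ab_group_add) gmod \<Rightarrow> ('b \<Rightarrow> 'c) \<Rightarrow>
   ('s, 'c::ab_group_add) gmod \<Rightarrow> bool" where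
  "short_exact A f B g C \<longleftrightarrow>
     gmono A f B \<and> ghom 0 B C g \<and> f ` carr A = gker B g \<and> g ` carr B = carr C"

definition exact4 ::
  "('s, 'a::ab_group_add) gmod \<Rightarrow> ('a \<Rightarrow> 'b) \<Rightarrow> ('s, 'b::ab_group_add) gmod \<Rightarrow> ('b \<Rightarrow> 'c) \<Rightarrow>
   ('s, 'c::ab_group_add) gmod \<Rightarrow> ('c \<Rightarrow> 'd) \<Rightarrow> ('s, 'd::ab_group_add) gmod \<Rightarrow> bool" where
  "exact4 A f B g C h D \<longleftrightarrow>
     gmono A f B \<and> ghom 0 B C g \<and> ghom 0 C D h \<and>
     f ` carr A = gker B g \<and> g ` carr B = gker C h \<and> h ` carr C = carr D"

definition graded_ideal :: "('n::finite, 'k::field) mpoly set \<Rightarrow> bool" where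
  "graded_ideal I \<longleftrightarrow>
     module.subspace (*) I \<and> I = module.span (*) {f \<in> I. \<exists>d. f \<in> homog d}"


section \<open>The Koszul complex\<close>

definition koszul ::
  "nat \<Rightarrow> (('n::{finite,linorder}, 'k::field) mpoly, 'n set \<Rightarrow> ('n, 'k) mpoly) gmod" where
  "koszul j = free_gmod {J. card J = j} (\<lambda>_. int j)"

text \<open>
  \<open>\<partial> e\<^sub>J = \<Sum>\<^sub>k (-1)\<^bsup>k+1\<^esup> x\<^bsub>j\<^sub>k\<^esub> e\<^bsub>J - {j\<^sub>k}\<^esub>\<close> for \<open>J = {j\<^sub>1 < j\<^sub>2 < \<dots>}\<close>, where \<open>k\<close> is the number of
  elements of \<open>J\<close> that are \<open>\<le> j\<^sub>k\<close>.  This one function is the differential in all homological degrees: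
  \<open>\<partial>\<^sub>j\<close> is its restriction to \<open>K\<^sub>j\<close>.
\<close>

definition koszul_diff ::
  "('n::{finite,linorder} set \<Rightarrow> ('n, 'k::field) mpoly) \<Rightarrow> ('n set \<Rightarrow> ('n, 'k) mpoly)" where
  "koszul_diff v =
     (\<Sum>J\<in>UNIV. smult (v J)
        (\<Sum>i\<in>J. smult ((-1) ^ (card {l \<in> J. l \<le> i} + 1) * var i) (basis (J - {i}))))"

definition syz :: "nat \<Rightarrow> ('n::{finite,linorder} set \<Rightarrow> ('n, 'k::field) mpoly) set" where
  "syz j = koszul_diff ` carr (koszul j)"

text \<open>The syzygy module \<open>E\<^sub>j \<subseteq> K\<^bsub>j-1\<^esub>\<close>, for \<open>j \<ge> 1\<close>.\<close>

definition syz_gmod ::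
  "nat \<Rightarrow> (('n::{finite,linorder}, 'k::field) mpoly, 'n set \<Rightarrow> ('n, 'k) mpoly) gmod" where
  "syz_gmod j = gsub (koszul (j - 1)) (syz j)"

definition shuffle_sign :: "'n::linorder set \<Rightarrow> 'n set \<Rightarrow> ('n, 'k::field) mpoly" where
  "shuffle_sign J L = (-1) ^ card {(j, k). j \<in> J \<and> k \<in> L \<and> j > k}"

definition dual_basis :: "'x \<Rightarrow> ('x \<Rightarrow> 's) \<Rightarrow> 's" where
  "dual_basis x = (\<lambda>v. v x)"

text \<open>
  The generator of \<open>\<^bold>A\<close> attached to \<open>L = {i\<^sub>1 < i\<^sub>2 < \<dots>}\<close>.  The sum runs over \<open>i = i\<^sub>j \<in> L\<close>, where \<open>j\<close> is the
  number of elements of \<open>L\<close> that are \<open>\<le> i\<close>.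
\<close>

definition A_gen ::
  "'n::{finite,linorder} set \<Rightarrow> ('n set \<Rightarrow> ('n, 'k::field) mpoly) \<Rightarrow> ('n, 'k) mpoly" where
  "A_gen L =
     (\<Sum>i\<in>L. smult ((-1) ^ (card {l \<in> L. l \<le> i} + 1) * shuffle_sign (L - {i}) ((UNIV - L) \<union> {i}) * var i)
               (dual_basis ((UNIV - L) \<union> {i})))"

definition A_mod ::
  "nat \<Rightarrow> (('n::{finite,linorder} set \<Rightarrow> ('n, 'k::field) mpoly) \<Rightarrow> ('n, 'k) mpoly) set" where
  "A_mod t = module.span smult {A_gen L | L. card L = CARD('n) - t}"


section \<open>The two conditions\<close>

text \<open>
  Without the requirement \<open>f g\<^sub>i \<noteq> 0\<close> on the free basis of the middle module (the \<open>basis i\<close>), the sequence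
  could be padded by a summand \<open>S(-b) \<rightarrow> S(-b) \<rightarrow> 0\<close> of any degree, which no \<open>\<beta>\<^sub>i\<close> outside \<open>E\<^bsub>t+2\<^esub>\<close> can match:
  \<open>f g\<^sub>i = \<partial> \<beta>\<^sub>i\<close>, and \<open>E\<^bsub>t+2\<^esub>\<close> is the kernel of \<open>\<partial>\<^bsub>t+1\<^esub>\<close>.  The predicate below is the bare exact sequence;
  this requirement has to be stated alongside it.
\<close>

definition long_bourbaki ::
  "nat \<Rightarrow> int \<Rightarrow> nat \<Rightarrow> (nat \<Rightarrow> int) \<Rightarrow> nat \<Rightarrow> (nat \<Rightarrow> int) \<Rightarrow>
   ('n::{finite,linorder}, 'k::field) mpoly set \<Rightarrow>
   ((nat \<Rightarrow> ('n, 'k) mpoly) \<Rightarrow> (nat \<Rightarrow> ('n, 'k) mpoly)) \<Rightarrow>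
   ((nat \<Rightarrow> ('n, 'k) mpoly) \<Rightarrow> ('n set \<Rightarrow> ('n, 'k) mpoly)) \<Rightarrow>
   (('n set \<Rightarrow> ('n, 'k) mpoly) \<Rightarrow> ('n, 'k) mpoly) \<Rightarrow> bool" where
  "long_bourbaki t c p a q b I \<alpha> f \<pi> \<longleftrightarrow>
     graded_ideal I \<and>
     exact4 (free_gmod {1..p} a) \<alpha> (free_gmod {1..q} b) f (syz_gmod (t + 1)) \<pi>
            (shift c (gsub ring_gmod I))"

text \<open>
  The commutative diagram, for \<open>F = \<Oplus> S(-a\<^sub>i)\<close> and \<open>G = \<Oplus> S(-b\<^sub>i)\<close>.  The embedding \<open>\<iota>\<close> is the middle row,
  \<open>Res(\<beta>) = \<beta> \<circ> \<iota>\<close>, the top row is the restriction of \<open>\<iota>\<close>, and the remaining horizontal and vertical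
  maps are inclusions; with these maps both squares commute.
\<close>

definition res_diagram ::
  "nat \<Rightarrow> nat \<Rightarrow> (nat \<Rightarrow> int) \<Rightarrow> nat \<Rightarrow> (nat \<Rightarrow> int) \<Rightarrow>
   (nat \<Rightarrow> 'n::{finite,linorder} set \<Rightarrow> ('n, 'k::field) mpoly) \<Rightarrow> bool" where
  "res_diagram t p a q b \<beta>s \<longleftrightarrow>
     (\<exists>(\<beta> :: (nat \<Rightarrow> ('n, 'k) mpoly) \<Rightarrow> ('n set \<Rightarrow> ('n, 'k) mpoly))
       (\<iota> :: (nat \<Rightarrow> ('n, 'k) mpoly) \<Rightarrow> (nat \<Rightarrow> ('n, 'k) mpoly)).
        let F = free_gmod {1..p} a;
            G = free_gmod {1..q} b;
            B = module.span smult (\<beta>s ` {1..q});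
            Bm = gsub (koszul (t + 1)) B;
            BE = gsub (koszul (t + 1)) (B \<inter> syz (t + 2));
            Res = (\<lambda>u. \<beta> (\<iota> u));
            KerRes = gsub F (gker F Res);
            Ker\<beta> = gsub G (gker G \<beta>)
        in (\<forall>i\<in>{1..q}. \<beta> (basis i) = \<beta>s i) \<and>
           giso KerRes \<iota> Ker\<beta> \<and>
           gmono F \<iota> G \<and>
           gmono BE (\<lambda>v. v) Bm \<and>
           short_exact KerRes (\<lambda>u. u) F Res BE \<and>
           short_exact Ker\<beta> (\<lambda>u. u) G \<beta> Bm)"

definition bourbaki_data ::
  "nat \<Rightarrow> int \<Rightarrow> nat \<Rightarrow> (nat \<Rightarrow> int) \<Rightarrow> nat \<Rightarrow> (nat \<Rightarrow> int) \<Rightarrow>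
   (nat \<Rightarrow> 'n::{finite,linorder} set \<Rightarrow> ('n, 'k::field) mpoly) \<Rightarrow>
   (('n set \<Rightarrow> ('n, 'k) mpoly) \<Rightarrow> ('n, 'k) mpoly) \<Rightarrow> bool" where
  "bourbaki_data t c p a q b \<beta>s \<phi> \<longleftrightarrow>
     (\<forall>i\<in>{1..q}. \<beta>s i \<in> carr (koszul (t + 1)) - syz (t + 2)) \<and>
     \<phi> \<in> A_mod t \<and>
     ghom (int CARD('n) + c) (koszul (t + 1)) (shift (- int CARD('n)) ring_gmod) \<phi> \<and>
     gker (koszul (t + 1)) \<phi> =
       {u + v | u v. u \<in> module.span smult (\<beta>s ` {1..q}) \<and> v \<in> syz (t + 2)} \<and>
     int p = int q + 1 - int ((CARD('n) - 1) choose t) \<and>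
     res_diagram t p a q b \<beta>s"

end

theory Submission
  imports Defs
begin

text \<open>
  The differential \<open>\<partial>\<close> maps \<open>K\<^bsub>t+1\<^esub>\<close> onto \<open>E\<^bsub>t+1\<^esub>\<close> with kernel \<open>E\<^bsub>t+2\<^esub>\<close>, and \<open>K\<^bsub>t+1\<^esub>\<close> is free.  Hence a map
  \<open>\<pi>: E\<^bsub>t+1\<^esub> \<rightarrow> S(c)\<close> is the same as a functional \<open>\<phi> = \<pi> \<circ> \<partial>\<close> on \<open>K\<^bsub>t+1\<^esub>\<close> that vanishes on \<open>E\<^bsub>t+2\<^esub>\<close>, and a map
  \<open>f: G \<rightarrow> E\<^bsub>t+1\<^esub>\<close> from a free module lifts to \<open>\<beta>: G \<rightarrow> K\<^bsub>t+1\<^esub>\<close> with \<open>\<partial> \<circ> \<beta> = f\<close>.  Under this dictionary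
  exactness at \<open>E\<^bsub>t+1\<^esub>\<close> says that \<open>Ker \<phi> = \<langle>\<beta>\<^sub>1, \<dots>, \<beta>\<^sub>q\<rangle> + E\<^bsub>t+2\<^esub>\<close>, and exactness at \<open>G\<close> says that \<open>F\<close> is the
  preimage of \<open>E\<^bsub>t+2\<^esub>\<close> under \<open>\<beta>\<close>, which is what the diagram expresses.  The two translations are
  \<open>bourbaki_sequence_imp_data\<close> and \<open>bourbaki_data_imp_sequence\<close>.  In the first one, two assertions need
  more than the dictionary.

  The functional \<open>\<phi>\<close> lies in \<open>\<^bold>A\<close>.  The generators of \<open>\<^bold>A\<close> are, up to sign, the functionals \<open>e\<^sub>M\<^sup>* \<circ> \<partial>\<close>
  (\<open>A_gen_eq_koszul_diff\<close>), so \<open>\<^bold>A\<close> is the image of \<open>K\<^sub>t\<^sup>*\<close> under the transpose of \<open>\<partial>\<close>.  As \<open>\<phi> \<circ> \<partial> = 0\<close>, it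
  suffices that the dual Koszul complex is exact at \<open>K\<^bsub>t+1\<^esub>\<^sup>*\<close>, which holds for \<open>t + 1 < n\<close>
  (\<open>functional_in_A_mod\<close>).  Exactness of the complex and of its dual is proved at once in
  \<open>kdiff_exact\<close>, from an explicit homotopy that removes one variable.

  The ranks satisfy \<open>p = q + 1 - ((n - 1) choose t)\<close>.  This is additivity of rank along the sequence, as
  \<open>E\<^bsub>t+1\<^esub>\<close> has rank \<open>(n - 1) choose t\<close> and a nonzero ideal has rank 1.  Ranks are compared over
  the domain itself: an injective map between free modules over a domain cannot lower the number of generators,
  since a homogeneous linear system with more unknowns than equations has a nonzero solution
  (\<open>card_eq_of_generic_iso\<close>, \<open>bourbaki_rank\<close>).  The case \<open>I = 0\<close> has to be excluded separately: it would
  make \<open>E\<^bsub>t+1\<^esub>\<close> a module with a free resolution of length 1, whereas its minimal resolution, the tail of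
  the Koszul complex, is longer (\<open>syz_no_short_resolution\<close>).
\<close>

section \<open>Linear maps out of free modules\<close>

interpretation fam: module "smult :: 's::comm_ring_1 \<Rightarrow> ('x \<Rightarrow> 's) \<Rightarrow> ('x \<Rightarrow> 's)"
  by (rule module_smult)

lemma sum_fun_apply: "(\<Sum>x\<in>X. f x) y = (\<Sum>x\<in>X. f x y)"
  by (induction X rule: infinite_finite_induct) auto

definition supp_in :: "'x set \<Rightarrow> ('x \<Rightarrow> 's::zero) set" where
  "supp_in X = {v. \<forall>x. x \<notin> X \<longrightarrow> v x = 0}"

lemma supp_inI: "(\<And>x. x \<notin> X \<Longrightarrow> v x = 0) \<Longrightarrow> v \<in> supp_in X"
  by (simp add: supp_in_def)

lemma supp_inD: "v \<in> supp_in X \<Longrightarrow> x \<notin> X \<Longrightarrow> v x = 0"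
  by (simp add: supp_in_def)

lemma subspace_supp_in: "fam.subspace (supp_in X)"
  by (rule fam.subspaceI) (auto simp: supp_in_def smult_def)

lemma basis_supp_in: "x \<in> X \<Longrightarrow> basis x \<in> supp_in X"
  by (auto simp: supp_in_def basis_def)

lemma carr_free: "carr (free_gmod X w) = supp_in X"
  by (simp add: free_gmod_def supp_in_def)

lemma act_free [simp]: "act (free_gmod X w) = smult"
  by (simp add: free_gmod_def)

lemma hpart_free: "hpart (free_gmod X w) d = {v \<in> supp_in X. \<forall>x\<in>X. v x \<in> homog (d - w x)}"
  by (auto simp: free_gmod_def supp_in_def shift_def ring_gmod_def)

definition lin_ext :: "'x set \<Rightarrow> ('x \<Rightarrow> 'y \<Rightarrow> 's::comm_ring_1) \<Rightarrow> ('x \<Rightarrow> 's) \<Rightarrow> ('y \<Rightarrow> 's)" where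
  "lin_ext X b v = (\<Sum>x\<in>X. smult (v x) (b x))"

lemma lin_ext_apply: "lin_ext X b v y = (\<Sum>x\<in>X. v x * b x y)"
  by (simp add: lin_ext_def sum_fun_apply smult_def)

lemma module_hom_lin_ext: "module_hom smult smult (lin_ext X b)"
proof -
  have "lin_ext X b (u + v) = lin_ext X b u + lin_ext X b v" for u v
    by (simp add: lin_ext_def fam.scale_left_distrib sum.distrib)
  moreover have "lin_ext X b (smult r v) = smult r (lin_ext X b v)" for r v
    by (simp add: lin_ext_def fam.scale_sum_right smult_def[of r v])
  ultimately show ?thesis
    by (simp add: module_hom_iff module_smult)
qed

lemma lin_ext_basis: "finite X \<Longrightarrow> x \<in> X \<Longrightarrow> lin_ext X b (basis x) = b x"
  by (rule ext) (simp add: lin_ext_apply basis_def if_distrib[of "\<lambda>c. c * _"] cong: if_cong)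

lemma lin_ext_cong: "(\<And>x. x \<in> X \<Longrightarrow> b x = b' x) \<Longrightarrow> lin_ext X b v = lin_ext X b' v"
  by (simp add: lin_ext_def)

lemma lin_ext_in_subspace:
  "fam.subspace U \<Longrightarrow> (\<And>x. x \<in> X \<Longrightarrow> b x \<in> U) \<Longrightarrow> lin_ext X b v \<in> U"
  unfolding lin_ext_def by (intro fam.subspace_sum fam.subspace_scale)

lemma supp_in_expand: "finite X \<Longrightarrow> v \<in> supp_in X \<Longrightarrow> lin_ext X basis v = v"
  by (rule ext)
    (auto simp: lin_ext_apply basis_def supp_in_def if_distrib[of "\<lambda>c. _ * c"] cong: if_cong)

lemma hom_eq_lin_ext:
  assumes "module_hom smult smult f" "finite X" "v \<in> supp_in X"
  shows "f v = lin_ext X (\<lambda>x. f (basis x)) v"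
proof -
  have "f v = f (lin_ext X basis v)" by (simp add: supp_in_expand assms)
  also have "\<dots> = lin_ext X (\<lambda>x. f (basis x)) v"
    by (simp add: lin_ext_def module_hom.sum[OF assms(1)] module_hom.scale[OF assms(1)])
  finally show ?thesis .
qed

lemma functional_expand:
  assumes "module_hom smult (*) \<phi>" "finite X" "v \<in> supp_in X"
  shows "\<phi> v = (\<Sum>x\<in>X. v x * \<phi> (basis x))"
proof -
  have "\<phi> v = \<phi> (lin_ext X basis v)" by (simp add: supp_in_expand assms)
  also have "\<dots> = (\<Sum>x\<in>X. v x * \<phi> (basis x))"
    by (simp add: lin_ext_def module_hom.sum[OF assms(1)] module_hom.scale[OF assms(1)])
  finally show ?thesis .
qed

lemma span_image_eq_lin_ext:
  assumes "finite X"
  shows "fam.span (b ` X) = lin_ext X b ` supp_in X"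
proof
  interpret l: module_hom smult smult "lin_ext X b" by (rule module_hom_lin_ext)
  show "fam.span (b ` X) \<subseteq> lin_ext X b ` supp_in X"
  proof (rule fam.span_minimal)
    show "b ` X \<subseteq> lin_ext X b ` supp_in X"
    proof
      fix y assume "y \<in> b ` X"
      then obtain x where "x \<in> X" "y = b x" by blast
      then show "y \<in> lin_ext X b ` supp_in X"
        using assms by (intro image_eqI[where x = "basis x"]) (simp_all add: lin_ext_basis basis_supp_in)
    qed
    show "fam.subspace (lin_ext X b ` supp_in X)"
      by (rule l.subspace_image[OF subspace_supp_in])
  qed
  show "lin_ext X b ` supp_in X \<subseteq> fam.span (b ` X)"
    by (blast intro: lin_ext_in_subspace fam.span_base fam.subspace_span)
qed

lemma ghom_free_expand:
  assumes f: "ghom d (free_gmod X w) N f" and X: "finite X" and v: "v \<in> supp_in X"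
  shows "f v = (\<Sum>x\<in>X. act N (v x) (f (basis x)))"
proof -
  have add: "f (u + u') = f u + f u'" if "u \<in> supp_in X" "u' \<in> supp_in X" for u u'
    using f that by (auto simp: ghom_def carr_free)
  have f0: "f 0 = 0"
    using add[OF fam.subspace_0[OF subspace_supp_in] fam.subspace_0[OF subspace_supp_in]]
    by (metis add.right_neutral add_left_cancel)
  have "f (lin_ext Y basis v) = (\<Sum>x\<in>Y. act N (v x) (f (basis x)))" if "Y \<subseteq> X" for Y
    using finite_subset[OF that X] that
  proof induction
    case empty
    show ?case by (simp add: lin_ext_def f0 zero_fun_def[symmetric])
  next
    case (insert y Y)
    have "lin_ext (insert y Y) basis v = smult (v y) (basis y) + lin_ext Y basis v"
      using insert by (simp add: lin_ext_def)
    moreover have "smult (v y) (basis y) \<in> supp_in X" "lin_ext Y basis v \<in> supp_in X"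
      using insert by (auto intro!: lin_ext_in_subspace subspace_supp_in basis_supp_in
          fam.subspace_scale[OF subspace_supp_in])
    moreover have "f (smult (v y) (basis y)) = act N (v y) (f (basis y))"
      using f insert by (auto simp: ghom_def carr_free basis_supp_in)
    ultimately have "f (lin_ext (insert y Y) basis v) = act N (v y) (f (basis y)) + f (lin_ext Y basis v)"
      by (simp only: add)
    then show ?case
      using insert by simp
  qed
  from this[of X] show ?thesis by (simp add: supp_in_expand X v)
qed

lemma hom_lin_ext: "module_hom smult smult f \<Longrightarrow> f (lin_ext X b v) = lin_ext X (\<lambda>x. f (b x)) v"
  by (simp add: lin_ext_def module_hom.sum module_hom.scale)

text \<open>Free modules are projective: preimages of the values at the basis extend linearly.\<close>

lemma free_lift:
  assumes g: "module_hom smult smult g" and f: "module_hom smult smult f"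
    and X: "finite X" and A: "fam.subspace A"
    and ex: "\<And>x. x \<in> X \<Longrightarrow> \<exists>a\<in>A. f a = g (basis x)"
  obtains h where "module_hom smult smult h" "\<And>v. h v \<in> A" "\<And>v. v \<in> supp_in X \<Longrightarrow> f (h v) = g v"
proof -
  obtain b where b: "\<And>x. x \<in> X \<Longrightarrow> b x \<in> A" "\<And>x. x \<in> X \<Longrightarrow> f (b x) = g (basis x)"
    using ex by metis
  show thesis
  proof (rule that[OF module_hom_lin_ext[of X b]])
    show "lin_ext X b v \<in> A" for v
      by (rule lin_ext_in_subspace[OF A b(1)])
    show "f (lin_ext X b v) = g v" if "v \<in> supp_in X" for v
      unfolding hom_lin_ext[OF f] hom_eq_lin_ext[OF g X that] by (rule lin_ext_cong) (rule b(2))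
  qed
qed

lemma module_hom_comp:
  "module_hom smult smult f \<Longrightarrow> module_hom smult smult g \<Longrightarrow> module_hom smult smult (\<lambda>v. g (f v))"
  by (simp add: module_hom_iff)

lemma module_hom_minus:
  "module_hom smult smult f \<Longrightarrow> module_hom smult smult g \<Longrightarrow> module_hom smult smult (\<lambda>v. f v - g v)"
  by (auto simp: module_hom_iff fam.scale_right_diff_distrib)

lemma module_hom_ident: "module_hom smult smult (\<lambda>v. v)"
  by (simp add: module_hom_iff module_smult)

section \<open>Ranks of free modules over a domain\<close>

lemma homogeneous_system_nontrivial:
  fixes A :: "'y \<Rightarrow> 'x \<Rightarrow> 's::idom"
  assumes "finite Y" "finite X" "card Y < card X"
  shows "\<exists>v\<in>supp_in X. v \<noteq> 0 \<and> (\<forall>y\<in>Y. (\<Sum>x\<in>X. A y x * v x) = 0)"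
  using assms
proof (induction Y arbitrary: X A)
  case empty
  then obtain x where "x \<in> X" by fastforce
  then show ?case
    by (intro bexI[of _ "basis x"] basis_supp_in) (auto simp: basis_def fun_eq_iff)
next
  case (insert y Y)
  show ?case
  proof (cases "\<forall>x\<in>X. A y x = 0")
    case True
    obtain v where "v \<in> supp_in X" "v \<noteq> 0" "\<forall>z\<in>Y. (\<Sum>x\<in>X. A z x * v x) = 0"
      using insert.IH[of X A] insert.prems insert.hyps by (metis Suc_lessD card_insert_disjoint)
    then show ?thesis
      using True by (intro bexI[of _ v]) auto
  next
    case False
    then obtain x0 where x0: "x0 \<in> X" "A y x0 \<noteq> 0" by blast
    \<comment> \<open>fraction-free elimination of the unknown \<open>x0\<close>\<close>
    let ?X = "X - {x0}"
    have "card Y < card ?X" using insert x0 by simp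
    moreover have "finite ?X" using insert.prems by simp
    ultimately have "\<exists>v\<in>supp_in ?X. v \<noteq> 0 \<and>
        (\<forall>z\<in>Y. (\<Sum>x\<in>?X. (A y x0 * A z x - A z x0 * A y x) * v x) = 0)"
      by (intro insert.IH)
    then obtain v where v: "v \<in> supp_in ?X" "v \<noteq> 0"
      and sol: "\<And>z. z \<in> Y \<Longrightarrow> (\<Sum>x\<in>?X. (A y x0 * A z x - A z x0 * A y x) * v x) = 0"
      by blast
    define u where "u x = (if x = x0 then - (\<Sum>x\<in>?X. A y x * v x) else A y x0 * v x)" for x
    have split: "(\<Sum>x\<in>X. A z x * u x) =
        (\<Sum>x\<in>?X. A y x0 * A z x * v x) - A z x0 * (\<Sum>x\<in>?X. A y x * v x)" for z
    proof -
      have "(\<Sum>x\<in>X. A z x * u x) = A z x0 * u x0 + (\<Sum>x\<in>?X. A z x * u x)"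
        using insert.prems x0 by (simp add: sum.remove)
      also have "(\<Sum>x\<in>?X. A z x * u x) = (\<Sum>x\<in>?X. A y x0 * A z x * v x)"
        by (rule sum.cong) (auto simp: u_def ac_simps)
      finally show ?thesis by (simp add: u_def)
    qed
    have "(\<Sum>x\<in>X. A z x * u x) = 0" if "z \<in> insert y Y" for z
    proof (cases "z = y")
      case True
      then show ?thesis by (simp add: split sum_distrib_left mult.assoc)
    next
      case False
      then have "(\<Sum>x\<in>?X. (A y x0 * A z x - A z x0 * A y x) * v x) = 0"
        using sol that by auto
      then show ?thesis
        by (simp add: split left_diff_distrib sum_subtractf sum_distrib_left mult.assoc)
    qed
    moreover have "u \<noteq> 0"
    proof -
      obtain x where "v x \<noteq> 0" using v by (auto simp: fun_eq_iff)
      moreover from this have "x \<noteq> x0" using v by (auto simp: supp_in_def)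
      ultimately have "u x \<noteq> 0" using x0 by (simp add: u_def)
      then show ?thesis by (auto simp: fun_eq_iff)
    qed
    moreover have "u \<in> supp_in X"
      using v x0 by (auto simp: u_def supp_in_def)
    ultimately show ?thesis by blast
  qed
qed

lemma injective_imp_card_le:
  fixes \<Phi> :: "('x \<Rightarrow> 's::idom) \<Rightarrow> ('y \<Rightarrow> 's)"
  assumes "module_hom smult smult \<Phi>" "finite X" "finite Y"
    and into: "\<And>v. v \<in> supp_in X \<Longrightarrow> \<Phi> v \<in> supp_in Y"
    and inj: "\<And>v. v \<in> supp_in X \<Longrightarrow> \<Phi> v = 0 \<Longrightarrow> v = 0"
  shows "card X \<le> card Y"
proof (rule ccontr)
  assume "\<not> card X \<le> card Y"
  then obtain v where v: "v \<in> supp_in X" "v \<noteq> 0"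
    and sol: "\<And>y. y \<in> Y \<Longrightarrow> (\<Sum>x\<in>X. \<Phi> (basis x) y * v x) = 0"
    using homogeneous_system_nontrivial[of Y X "\<lambda>y x. \<Phi> (basis x) y"] assms by auto
  have "\<Phi> v y = 0" for y
  proof (cases "y \<in> Y")
    case True
    then show ?thesis
      using sol[OF True] by (simp add: hom_eq_lin_ext[OF assms(1,2) v(1)] lin_ext_apply mult.commute)
  qed (use into[OF v(1)] in \<open>auto simp: supp_in_def\<close>)
  then have "\<Phi> v = 0" by auto
  then show False using inj v by blast
qed

text \<open>
  A map of free modules is invertible over the fraction field as soon as it is injective and
  its image contains a nonzero multiple of the target.
\<close>

lemma card_eq_of_generic_iso:
  fixes \<Phi> :: "('x \<Rightarrow> 's::idom) \<Rightarrow> ('y \<Rightarrow> 's)"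
  assumes hom: "module_hom smult smult \<Phi>" and X: "finite X" and Y: "finite Y"
    and into: "\<And>v. v \<in> supp_in X \<Longrightarrow> \<Phi> v \<in> supp_in Y"
    and inj: "\<And>v. v \<in> supp_in X \<Longrightarrow> \<Phi> v = 0 \<Longrightarrow> v = 0"
    and r: "r \<noteq> 0"
    and surj: "\<And>y. y \<in> Y \<Longrightarrow> \<exists>w\<in>supp_in X. \<Phi> w = smult r (basis y)"
  shows "card X = card Y"
proof (rule antisym)
  show "card X \<le> card Y"
    by (rule injective_imp_card_le[OF hom X Y into inj])
  obtain w where w: "\<And>y. y \<in> Y \<Longrightarrow> w y \<in> supp_in X"
    and \<Phi>w: "\<And>y. y \<in> Y \<Longrightarrow> \<Phi> (w y) = smult r (basis y)"
    using surj by metis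
  interpret h: module_hom smult smult \<Phi> by (rule hom)
  have right_inverse: "\<Phi> (lin_ext Y w v) = smult r v" if "v \<in> supp_in Y" for v
  proof -
    have "\<Phi> (lin_ext Y w v) = (\<Sum>y\<in>Y. smult (v y) (smult r (basis y)))"
      by (simp add: lin_ext_def h.sum h.scale \<Phi>w del: fam.scale_scale)
    also have "\<dots> = smult r (lin_ext Y basis v)"
      by (simp add: lin_ext_def fam.scale_sum_right mult.commute)
    finally show ?thesis by (simp add: supp_in_expand Y that)
  qed
  show "card Y \<le> card X"
  proof (rule injective_imp_card_le[OF module_hom_lin_ext Y X])
    show "lin_ext Y w v \<in> supp_in X" for v
      by (intro lin_ext_in_subspace subspace_supp_in w)
    show "v = 0" if "v \<in> supp_in Y" "lin_ext Y w v = 0" for v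
      using right_inverse[OF that(1)] r by (auto simp: that smult_def fun_eq_iff)
  qed
qed

section \<open>Components, orders and division in the polynomial ring\<close>

lemma mon_deg_add: "mon_deg (m + m') = mon_deg m + mon_deg m'"
  by (simp add: mon_deg_def lookup_add sum.distrib)

lemma mon_deg_single: "mon_deg (Poly_Mapping.single i k) = k"
  by (simp add: mon_deg_def lookup_single when_def)

lemma homog_0: "0 \<in> homog d"
  by (simp add: homog_def)

lemma homog_add: "f \<in> homog d \<Longrightarrow> g \<in> homog d \<Longrightarrow> f + g \<in> homog d"
  using keys_add[of f g] by (auto simp: homog_def)

lemma keys_uminus: "Poly_Mapping.keys (- f) = Poly_Mapping.keys f"
  by (auto simp: in_keys_iff)

lemma homog_sum: "(\<And>x. x \<in> X \<Longrightarrow> f x \<in> homog d) \<Longrightarrow> sum f X \<in> homog d"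
  by (induction X rule: infinite_finite_induct) (auto simp: homog_0 homog_add)

lemma homog_mult:
  assumes "f \<in> homog d" "g \<in> homog e"
  shows "f * g \<in> homog (d + e)"
  unfolding homog_def
proof safe
  fix m assume "m \<in> Poly_Mapping.keys (f * g)"
  then obtain a b where "a \<in> Poly_Mapping.keys f" "b \<in> Poly_Mapping.keys g" "m = a + b"
    using keys_mult[of f g] by blast
  then show "int (mon_deg m) = d + e"
    using assms by (auto simp: homog_def mon_deg_add)
qed

lemma homog_one: "1 \<in> homog 0"
  by (auto simp: homog_def mon_deg_def)

lemma homog_var: "var i \<in> homog 1"
  by (auto simp: homog_def var_def mon_deg_single)

lemma var_nonzero: "var i \<noteq> (0 :: ('n, 'k::field) mpoly)"
  by (metis lookup_single_eq lookup_zero var_def zero_neq_one)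

definition homog_comp :: "int \<Rightarrow> ('n::finite, 'k::field) mpoly \<Rightarrow> ('n, 'k) mpoly" where
  "homog_comp d f = Poly_Mapping.mapp (\<lambda>m c. c when int (mon_deg m) = d) f"

lemma lookup_homog_comp:
  "Poly_Mapping.lookup (homog_comp d f) m = (Poly_Mapping.lookup f m when int (mon_deg m) = d)"
  by (simp add: homog_comp_def lookup_mapp when_def in_keys_iff)

lemma homog_comp_homog: "homog_comp d f \<in> homog d"
  by (auto simp: homog_def in_keys_iff lookup_homog_comp)

lemma homog_comp_id: "f \<in> homog d \<Longrightarrow> homog_comp d f = f"
  by (rule poly_mapping_eqI) (auto simp: lookup_homog_comp homog_def in_keys_iff when_def)

lemma homog_comp_0 [simp]: "homog_comp d 0 = 0"
  by (rule poly_mapping_eqI) (simp add: lookup_homog_comp)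

lemma homog_comp_add: "homog_comp d (f + g) = homog_comp d f + homog_comp d g"
  by (rule poly_mapping_eqI) (simp add: lookup_homog_comp lookup_add when_def)

lemma homog_comp_uminus: "homog_comp d (- f) = - homog_comp d f"
  by (rule poly_mapping_eqI) (simp add: lookup_homog_comp when_def)

lemma homog_comp_sum: "homog_comp d (sum f X) = (\<Sum>x\<in>X. homog_comp d (f x))"
  by (induction X rule: infinite_finite_induct) (auto simp: homog_comp_add)

lemma lookup_var_mult:
  "Poly_Mapping.lookup (var i * f) m =
     (Poly_Mapping.lookup f (m - Poly_Mapping.single i 1) when Poly_Mapping.lookup m i \<noteq> 0)"
proof -
  have dec: "(m = Poly_Mapping.single i 1 + l) =
      (l = m - Poly_Mapping.single i 1 \<and> Poly_Mapping.lookup m i \<noteq> 0)" for l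
  proof
    assume "m = Poly_Mapping.single i 1 + l"
    then show "l = m - Poly_Mapping.single i 1 \<and> Poly_Mapping.lookup m i \<noteq> 0"
      by (simp add: lookup_add)
  next
    assume *: "l = m - Poly_Mapping.single i 1 \<and> Poly_Mapping.lookup m i \<noteq> 0"
    show "m = Poly_Mapping.single i 1 + l"
      by (rule poly_mapping_eqI)
        (use * in \<open>auto simp: lookup_add lookup_minus lookup_single when_def\<close>)
  qed
  have "Poly_Mapping.lookup (var i * f) m =
    (\<Sum>k. (1 when Poly_Mapping.single i 1 = k) *
       (\<Sum>l. Poly_Mapping.lookup f l when m = k + l))"
    by (simp add: var_def times_poly_mapping.rep_eq prod_fun_def lookup_single)
  also have "\<dots> = (\<Sum>k. (\<Sum>l. Poly_Mapping.lookup f l when m = k + l)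
      when Poly_Mapping.single i 1 = k)"
    by (rule Sum_any.cong) (simp add: when_def)
  also have "\<dots> = (\<Sum>l. Poly_Mapping.lookup f l when m = Poly_Mapping.single i 1 + l)"
    by simp
  also have "\<dots> = (\<Sum>l. (Poly_Mapping.lookup f l when Poly_Mapping.lookup m i \<noteq> 0)
      when l = m - Poly_Mapping.single i 1)"
    unfolding dec by (rule Sum_any.cong) (simp add: when_def)
  finally show ?thesis by simp
qed

lemma homog_comp_var_mult: "homog_comp (d + 1) (var i * f) = var i * homog_comp d f"
proof (rule poly_mapping_eqI)
  fix m
  have "mon_deg m = mon_deg (m - Poly_Mapping.single i 1) + 1" if "Poly_Mapping.lookup m i \<noteq> 0"
  proof -
    have "m = (m - Poly_Mapping.single i 1) + Poly_Mapping.single i 1"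
      by (rule poly_mapping_eqI)
        (use that in \<open>auto simp: lookup_add lookup_minus lookup_single when_def\<close>)
    then show ?thesis by (metis mon_deg_add mon_deg_single)
  qed
  then show "Poly_Mapping.lookup (homog_comp (d + 1) (var i * f)) m =
      Poly_Mapping.lookup (var i * homog_comp d f) m"
    by (auto simp: lookup_homog_comp lookup_var_mult when_def)
qed

text \<open>The power \<open>\<mm>\<^sup>k\<close> of the irrelevant ideal.\<close>

definition ord_ge :: "nat \<Rightarrow> ('n::finite, 'k::field) mpoly set" where
  "ord_ge k = {f. \<forall>m\<in>Poly_Mapping.keys f. k \<le> mon_deg m}"

lemma ord_ge_0: "f \<in> ord_ge 0"
  by (simp add: ord_ge_def)

lemma ord_ge_zero: "0 \<in> ord_ge k"
  by (simp add: ord_ge_def)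

lemma ord_ge_add: "f \<in> ord_ge k \<Longrightarrow> g \<in> ord_ge k \<Longrightarrow> f + g \<in> ord_ge k"
  using keys_add[of f g] by (auto simp: ord_ge_def)

lemma ord_ge_uminus: "- f \<in> ord_ge k \<longleftrightarrow> f \<in> ord_ge k"
  by (simp add: ord_ge_def keys_uminus)

lemma ord_ge_sum: "(\<And>x. x \<in> X \<Longrightarrow> f x \<in> ord_ge k) \<Longrightarrow> sum f X \<in> ord_ge k"
  by (induction X rule: infinite_finite_induct) (auto simp: ord_ge_add ord_ge_zero)

lemma ord_ge_mult:
  assumes "f \<in> ord_ge k" "g \<in> ord_ge l"
  shows "f * g \<in> ord_ge (k + l)"
  unfolding ord_ge_def
proof safe
  fix m assume "m \<in> Poly_Mapping.keys (f * g)"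
  then obtain a b where "a \<in> Poly_Mapping.keys f" "b \<in> Poly_Mapping.keys g" "m = a + b"
    using keys_mult[of f g] by blast
  then show "k + l \<le> mon_deg m"
    using assms by (auto simp: ord_ge_def mon_deg_add intro: add_mono)
qed

lemma ord_ge_var: "var i \<in> ord_ge k \<longleftrightarrow> k \<le> 1"
  by (simp add: ord_ge_def var_def mon_deg_single)

text \<open>Division by \<open>x\<^sub>i\<close> that discards the monomials free of \<open>x\<^sub>i\<close>; \<open>f - x\<^sub>i * vdiv i f\<close> is \<open>f\<close> at \<open>x\<^sub>i = 0\<close>.\<close>

definition vdiv :: "'n \<Rightarrow> ('n::finite, 'k::field) mpoly \<Rightarrow> ('n, 'k) mpoly" where
  "vdiv i f = Poly_Mapping.map_key (\<lambda>m. m + Poly_Mapping.single i 1) f"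

lemma lookup_vdiv:
  "Poly_Mapping.lookup (vdiv i f) m = Poly_Mapping.lookup f (m + Poly_Mapping.single i 1)"
  by (simp add: vdiv_def map_key.rep_eq inj_def)

lemma vdiv_add: "vdiv i (f + g) = vdiv i f + vdiv i g"
  by (rule poly_mapping_eqI) (simp add: lookup_vdiv lookup_add)

lemma vdiv_0 [simp]: "vdiv i 0 = 0"
  by (rule poly_mapping_eqI) (simp add: lookup_vdiv)

lemma vdiv_var_same: "vdiv i (var i * f) = f"
  by (rule poly_mapping_eqI) (simp add: lookup_vdiv lookup_var_mult lookup_add)

lemma vdiv_var_other: "i \<noteq> j \<Longrightarrow> vdiv i (var j * f) = var j * vdiv i f"
proof (rule poly_mapping_eqI)
  fix m :: "'a \<Rightarrow>\<^sub>0 nat"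
  assume "i \<noteq> j"
  have "m + Poly_Mapping.single i 1 - Poly_Mapping.single j 1 =
      m - Poly_Mapping.single j 1 + Poly_Mapping.single i 1" if "Poly_Mapping.lookup m j \<noteq> 0"
    by (rule poly_mapping_eqI)
      (use that \<open>i \<noteq> j\<close> in \<open>auto simp: lookup_add lookup_minus lookup_single when_def\<close>)
  then show "Poly_Mapping.lookup (vdiv i (var j * f)) m = Poly_Mapping.lookup (var j * vdiv i f) m"
    using \<open>i \<noteq> j\<close> by (auto simp: lookup_vdiv lookup_var_mult lookup_add lookup_single when_def)
qed

section \<open>Koszul complexes and their homotopies\<close>

text \<open>
  The Koszul complex is treated for arbitrary signs, \<open>s M j\<close> being the sign of \<open>x\<^sub>j e\<^sub>M\<close> in
  \<open>\<partial> e\<^bsub>M \<union> {j}\<^esub>\<close>.  The dual complex is then an instance as well, because complementation of index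
  sets exchanges the two up to the choice of signs.  The second condition below is what makes the
  differential square to zero.
\<close>

definition sign_system :: "('n set \<Rightarrow> 'n \<Rightarrow> 's::comm_ring_1) \<Rightarrow> bool" where
  "sign_system s \<longleftrightarrow>
     (\<forall>M j. s M j = 1 \<or> s M j = - 1) \<and>
     (\<forall>M i j. i \<notin> M \<longrightarrow> j \<notin> M \<longrightarrow> i \<noteq> j \<longrightarrow> s M i * s (insert i M) j = - (s M j * s (insert j M) i))"

definition kdiff ::
  "('n set \<Rightarrow> 'n \<Rightarrow> ('n::{finite,linorder}, 'k::field) mpoly) \<Rightarrow> ('n set \<Rightarrow> ('n, 'k) mpoly) \<Rightarrow> ('n set \<Rightarrow> ('n, 'k) mpoly)"
where
  "kdiff s v = (\<lambda>M. \<Sum>j\<in>-M. s M j * var j * v (insert j M))"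

text \<open>The operator \<open>v \<mapsto> e\<^sub>i \<and> D v\<close>, with \<open>D\<close> applied to the coefficients.\<close>

definition khom ::
  "('n set \<Rightarrow> 'n \<Rightarrow> ('n::{finite,linorder}, 'k::field) mpoly) \<Rightarrow> (('n, 'k) mpoly \<Rightarrow> ('n, 'k) mpoly) \<Rightarrow> 'n \<Rightarrow>
   ('n set \<Rightarrow> ('n, 'k) mpoly) \<Rightarrow> ('n set \<Rightarrow> ('n, 'k) mpoly)"
where
  "khom s D i v = (\<lambda>J. if i \<in> J then s (J - {i}) i * D (v (J - {i})) else 0)"

lemma sign_cases:
  assumes "sign_system s"
  obtains "s M j = 1" | "s M j = - 1"
  using assms by (auto simp: sign_system_def)

lemma sign_square: "sign_system s \<Longrightarrow> s M j * s M j = 1"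
  by (rule sign_cases[of s M j]) auto

lemma kdiff_add: "kdiff s (v + w) = kdiff s v + kdiff s w"
  by (simp add: kdiff_def fun_eq_iff algebra_simps sum.distrib)

lemma kdiff_smult: "kdiff s (smult r v) = smult r (kdiff s v)"
  by (simp add: kdiff_def smult_def fun_eq_iff algebra_simps sum_distrib_left)

lemma module_hom_kdiff: "module_hom smult smult (kdiff s)"
  by (simp add: module_hom_iff module_smult kdiff_add kdiff_smult)

lemmas kdiff_zero = module_hom.zero[OF module_hom_kdiff]
lemmas kdiff_diff = module_hom.diff[OF module_hom_kdiff]

lemma kdiff_kdiff:
  assumes s: "sign_system s"
  shows "kdiff s (kdiff s v) = 0"
proof (rule ext)
  fix M
  define g where "g i j = s M i * s (insert i M) j * var i * var j * v (insert j (insert i M))" for i j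
  let ?P = "Sigma (-M) (\<lambda>i. -(insert i M))"
  have "kdiff s (kdiff s v) M = (\<Sum>i\<in>-M. \<Sum>j\<in>-(insert i M). g i j)"
    by (simp add: kdiff_def g_def sum_distrib_left algebra_simps)
  also have "\<dots> = (\<Sum>(i, j)\<in>?P. g i j)"
    by (simp add: sum.Sigma)
  finally have eq: "kdiff s (kdiff s v) M = (\<Sum>(i, j)\<in>?P. g i j)" .
  have anti: "g j i = - g i j" if "(i, j) \<in> ?P" for i j
  proof -
    have "s M i * s (insert i M) j = - (s M j * s (insert j M) i)"
      using s that by (auto simp: sign_system_def)
    then show ?thesis
      by (simp add: g_def insert_commute algebra_simps)
  qed
  \<comment> \<open>Antisymmetry alone does not make the sum vanish in characteristic 2; the terms with
    \<open>i < j\<close> cancel those with \<open>j < i\<close>.\<close>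
  let ?A = "{p \<in> ?P. fst p < snd p}" and ?B = "{p \<in> ?P. snd p < fst p}"
  have PAB: "?P = ?A \<union> ?B"
    by auto
  have "(\<Sum>(i, j)\<in>?P. g i j) = (\<Sum>(i, j)\<in>?A. g i j) + (\<Sum>(i, j)\<in>?B. g i j)"
    by (subst PAB, rule sum.union_disjoint) auto
  also have "(\<Sum>(i, j)\<in>?B. g i j) = (\<Sum>(i, j)\<in>?A. g j i)"
    by (rule sum.reindex_bij_witness[where i = prod.swap and j = prod.swap]) auto
  also have "\<dots> = (\<Sum>(i, j)\<in>?A. - g i j)"
    by (intro sum.cong refl) (simp only: split_paired_all prod.case, rule anti, blast)
  also have "(\<Sum>(i, j)\<in>?A. g i j) + (\<Sum>(i, j)\<in>?A. - g i j) = 0"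
    by (simp add: sum.distrib[symmetric] case_prod_unfold)
  finally show "kdiff s (kdiff s v) M = 0 M"
    using eq by simp
qed

text \<open>
  The Cartan formula for the Koszul differential and wedging with \<open>e\<^sub>i\<close>: the terms with \<open>j \<noteq> i\<close>
  cancel by the sign rule because \<open>D\<close> commutes with \<open>x\<^sub>j\<close>.  With \<open>D = id\<close> it says that
  multiplication by \<open>x\<^sub>i\<close> is null-homotopic; with the division \<open>vdiv i\<close> for \<open>D\<close> it removes both
  \<open>x\<^sub>i\<close> and \<open>e\<^sub>i\<close> from a cycle, up to a boundary.
\<close>

lemma koszul_homotopy:
  assumes s: "sign_system s"
    and add: "\<And>f g. D (f + g) = D f + D g"
    and comm: "\<And>j f. j \<noteq> i \<Longrightarrow> D (var j * f) = var j * D f"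
  shows "kdiff s (khom s D i v) M + khom s D i (kdiff s v) M =
    (if i \<in> M then D (var i * v M) else var i * D (v M))"
proof -
  have D0: "D 0 = 0" using add[of 0 0] by (metis add.right_neutral add_left_cancel)
  have Dneg: "D (- f) = - D f" for f
    using add[of f "- f"] by (simp add: D0 eq_neg_iff_add_eq_0 add.commute)
  have Dsum: "D (sum g X) = (\<Sum>x\<in>X. D (g x))" if "finite X" for g :: "'a \<Rightarrow> _" and X
    using that by induction (auto simp: add D0)
  have Dsign: "D (s N j * f) = s N j * D f" for N j f
    by (rule sign_cases[OF s, of N j]) (auto simp: Dneg)
  show ?thesis
  proof (cases "i \<in> M")
    case False
    have "kdiff s (khom s D i v) M =
        (\<Sum>j\<in>-M. if j = i then s M i * var i * (s M i * D (v M)) else 0)"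
      unfolding kdiff_def khom_def using False by (intro sum.cong) auto
    also have "\<dots> = s M i * s M i * (var i * D (v M))"
      using False by (simp add: algebra_simps)
    finally show ?thesis
      using False by (simp add: sign_square[OF s] khom_def)
  next
    case True
    define N where "N = M - {i}"
    have N: "i \<notin> N" "M = insert i N" using True by (auto simp: N_def)
    have "kdiff s (khom s D i v) M =
        (\<Sum>j\<in>-M. s M j * s (insert j N) i * (var j * D (v (insert j N))))"
      unfolding kdiff_def khom_def
    proof (intro sum.cong refl)
      fix j assume "j \<in> - M"
      then have "insert j M - {i} = insert j N" "i \<in> insert j M" using N by auto
      then show "s M j * var j * (if i \<in> insert j M then s (insert j M - {i}) i * D (v (insert j M - {i})) else 0) =
          s M j * s (insert j N) i * (var j * D (v (insert j N)))"
        by (simp add: algebra_simps)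
    qed
    moreover have "khom s D i (kdiff s v) M =
        s N i * s N i * D (var i * v M) +
        (\<Sum>j\<in>-M. s N i * s N j * (var j * D (v (insert j N))))"
    proof -
      have "khom s D i (kdiff s v) M =
          s N i * D (\<Sum>j\<in>-N. s N j * (var j * v (insert j N)))"
        using True by (simp add: khom_def kdiff_def N_def mult.assoc)
      also have "\<dots> = s N i * (\<Sum>j\<in>-N. s N j * D (var j * v (insert j N)))"
        by (simp add: Dsum Dsign)
      also have "-N = insert i (-M)" using N by auto
      also have "s N i * (\<Sum>j\<in>insert i (-M). s N j * D (var j * v (insert j N))) =
          s N i * s N i * D (var i * v M) +
          (\<Sum>j\<in>-M. s N i * s N j * (var j * D (v (insert j N))))"
      proof -
        have "(\<Sum>j\<in>-M. s N i * (s N j * D (var j * v (insert j N)))) =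
          (\<Sum>j\<in>-M. s N i * s N j * (var j * D (v (insert j N))))"
          using N by (intro sum.cong refl) (auto simp: comm mult.assoc)
        then show ?thesis
          using N by (simp add: distrib_left sum_distrib_left mult.assoc)
      qed
      finally show ?thesis .
    qed
    ultimately have "kdiff s (khom s D i v) M + khom s D i (kdiff s v) M =
        D (var i * v M) + (\<Sum>j\<in>-M. (s M j * s (insert j N) i + s N i * s N j) * (var j * D (v (insert j N))))"
      by (simp add: sign_square[OF s] sum.distrib algebra_simps)
    also have "(\<Sum>j\<in>-M. (s M j * s (insert j N) i + s N i * s N j) * (var j * D (v (insert j N)))) = 0"
    proof (intro sum.neutral ballI)
      fix j assume "j \<in> - M"
      then have *: "s N i * s (insert i N) j = - (s N j * s (insert j N) i)"
        using s N unfolding sign_system_def by auto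
      have "s M j = - (s N i * s N j * s (insert j N) i)"
        using arg_cong[OF *, of "\<lambda>x. s N i * x"] N
        by (simp add: sign_square[OF s] mult.assoc[symmetric])
      then have "s M j * s (insert j N) i = - (s N i * s N j * (s (insert j N) i * s (insert j N) i))"
        by (simp add: mult.assoc)
      then show "(s M j * s (insert j N) i + s N i * s N j) * (var j * D (v (insert j N))) = 0"
        by (simp add: sign_square[OF s])
    qed
    finally show ?thesis using True by simp
  qed
qed

text \<open>
  Exactness over any field, by eliminating the variables one after the other: subtracting the
  boundary of \<open>khom s (vdiv i) i u\<close> from a cycle \<open>u\<close> kills its coefficients at the sets that contain
  \<open>i\<close> and sets \<open>x\<^sub>i = 0\<close> in the others, so that coefficients which vanish already stay zero.  In the
  end only the coefficient at the empty set could survive.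
\<close>

lemma kdiff_exact:
  assumes s: "sign_system s" and cyc: "kdiff s v = 0" and v0: "v {} = 0"
  shows "\<exists>w. kdiff s w = v"
proof -
  have "\<exists>w. \<forall>M. M = {} \<or> M \<inter> T \<noteq> {} \<longrightarrow> (v - kdiff s w) M = 0" for T :: "'a set"
    using finite[of T]
  proof induction
    case empty
    show ?case
      by (intro exI[of _ 0] allI impI, simp only: kdiff_zero) (use v0 in auto)
  next
    case (insert i T)
    then obtain w where w: "\<And>M. M = {} \<or> M \<inter> T \<noteq> {} \<Longrightarrow> (v - kdiff s w) M = 0" by blast
    define u where "u = v - kdiff s w"
    have "kdiff s u = 0"
      by (simp add: u_def kdiff_diff cyc kdiff_kdiff[OF s])
    then have "khom s (vdiv i) i (kdiff s u) = 0"
      by (simp add: khom_def fun_eq_iff)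
    then have hom: "kdiff s (khom s (vdiv i) i u) M =
        (if i \<in> M then vdiv i (var i * u M) else var i * vdiv i (u M))" for M
      using koszul_homotopy[OF s, of "vdiv i" i u M] by (simp add: vdiv_add vdiv_var_other)
    have "v - kdiff s (w + khom s (vdiv i) i u) = u - kdiff s (khom s (vdiv i) i u)"
      by (simp add: u_def kdiff_add)
    moreover have "(u - kdiff s (khom s (vdiv i) i u)) M = 0" if "M = {} \<or> M \<inter> insert i T \<noteq> {}" for M
    proof (cases "i \<in> M")
      case True
      then show ?thesis by (simp add: hom vdiv_var_same)
    next
      case False
      then have "u M = 0" using that w by (auto simp: u_def)
      then show ?thesis using False by (simp add: hom)
    qed
    ultimately show ?case by metis
  qed
  from this[of UNIV] obtain w where "\<And>M. (v - kdiff s w) M = 0" by auto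
  then have "kdiff s w = v" by (auto simp: fun_eq_iff)
  then show ?thesis by blast
qed

section \<open>The Koszul complex and its dual\<close>

definition ksign :: "'n::linorder set \<Rightarrow> 'n \<Rightarrow> 's::comm_ring_1" where
  "ksign M j = (-1) ^ card {l \<in> M. l < j}"

lemma ksign_cases: "(ksign M j :: 's::comm_ring_1) = 1 \<or> (ksign M j :: 's) = - 1"
  unfolding ksign_def by (cases "even (card {l \<in> M. l < j})") auto

lemma ksign_insert:
  fixes M :: "'n::{finite,linorder} set"
  assumes "i \<notin> M"
  shows "ksign (insert i M) j = (if i < j then - ksign M j else ksign M j)"
proof (cases "i < j")
  case True
  then have "{l \<in> insert i M. l < j} = insert i {l \<in> M. l < j}" by auto
  then show ?thesis using assms True by (simp add: ksign_def)
next
  case False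
  then have "{l \<in> insert i M. l < j} = {l \<in> M. l < j}" by auto
  then show ?thesis using False by (simp add: ksign_def)
qed

lemma sign_system_ksign:
  "sign_system (ksign :: 'n::{finite,linorder} set \<Rightarrow> 'n \<Rightarrow> 's::comm_ring_1)"
  unfolding sign_system_def by (auto simp: ksign_cases ksign_insert)

text \<open>
  The signs of the dual complex differ from those of the complex itself by factors that depend on
  \<open>j\<close> only, which do not affect the sign rule.
\<close>

lemma sign_system_dual_ksign:
  "sign_system (\<lambda>(M :: 'n::{finite,linorder} set) j. ksign (- insert j M) j :: 's::comm_ring_1)"
proof -
  have comp: "ksign (- insert j M) j = ksign UNIV j * (ksign M j :: 's)" for M :: "'n set" and j
  proof -
    have "{l \<in> UNIV. l < j} = {l \<in> - insert j M. l < j} \<union> {l \<in> M. l < j}" by auto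
    then have "card {l \<in> UNIV. l < j} = card {l \<in> - insert j M. l < j} + card {l \<in> M. l < j}"
      by (metis (no_types, lifting) Int_emptyI card_Un_disjoint finite_code mem_Collect_eq
          Compl_iff insertCI)
    then have "ksign UNIV j * (ksign M j :: 's) =
        ksign (- insert j M) j * (ksign M j * ksign M j)"
      by (simp add: ksign_def power_add mult.assoc)
    then show ?thesis by (simp add: sign_square[OF sign_system_ksign])
  qed
  have anti: "(ksign M i :: 's) * ksign (insert i M) j = - (ksign M j * ksign (insert j M) i)"
    if "i \<notin> M" "j \<notin> M" "i \<noteq> j" for M :: "'n set" and i j
    using sign_system_ksign[where 's = 's] that unfolding sign_system_def by blast
  have "ksign UNIV i * (ksign M i :: 's) * (ksign UNIV j * ksign (insert i M) j) =
      - (ksign UNIV j * ksign M j * (ksign UNIV i * ksign (insert j M) i))"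
    if "i \<notin> M" "j \<notin> M" "i \<noteq> j" for M :: "'n set" and i j
  proof -
    have "ksign UNIV i * (ksign M i :: 's) * (ksign UNIV j * ksign (insert i M) j) =
        ksign UNIV i * ksign UNIV j * (ksign M i * ksign (insert i M) j)"
      by (simp only: ac_simps)
    also have "\<dots> = - (ksign UNIV i * ksign UNIV j * (ksign M j * ksign (insert j M) i))"
      by (simp only: anti[OF that] mult_minus_right)
    finally show ?thesis by (simp only: ac_simps)
  qed
  then show ?thesis
    unfolding sign_system_def by (intro conjI allI impI) (rule ksign_cases, simp only: comp)
qed

lemma koszul_diff_eq: "koszul_diff = kdiff ksign"
proof (intro ext)
  fix v :: "'n::{finite,linorder} set \<Rightarrow> ('n, 'k::field) mpoly" and M
  define c where "c J i = (if J - {i} = M then ksign M i * var i * v J else 0)"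
    for J and i :: 'n
  have "koszul_diff v M = (\<Sum>J\<in>UNIV. \<Sum>i\<in>J.
      v J * ((-1) ^ (card {l \<in> J. l \<le> i} + 1) * var i * basis (J - {i}) M))"
    by (simp add: koszul_diff_def smult_def sum_fun_apply sum_distrib_left)
  also have "\<dots> = (\<Sum>J\<in>UNIV. \<Sum>i\<in>J. c J i)"
  proof (intro sum.cong refl)
    fix J and i :: 'n assume "i \<in> J"
    then have "{l \<in> J. l \<le> i} = insert i {l \<in> J - {i}. l < i}" by auto
    then have "card {l \<in> J. l \<le> i} = Suc (card {l \<in> J - {i}. l < i})" by simp
    then show "v J * ((-1) ^ (card {l \<in> J. l \<le> i} + 1) * var i * basis (J - {i}) M) = c J i"
      by (auto simp: c_def basis_def ksign_def mult_ac)
  qed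
  also have "\<dots> = (\<Sum>(J, i)\<in>Sigma UNIV (\<lambda>J. J). c J i)"
    by (simp add: sum.Sigma)
  also have "\<dots> = (\<Sum>(J, i)\<in>(\<lambda>j. (insert j M, j)) ` (- M). c J i)"
    by (rule sum.mono_neutral_right) (auto simp: c_def split: if_splits)
  also have "\<dots> = (\<Sum>j\<in>-M. c (insert j M) j)"
    by (subst sum.reindex) (auto simp: inj_on_def)
  also have "\<dots> = kdiff ksign v M"
    unfolding kdiff_def by (rule sum.cong) (auto simp: c_def)
  finally show "koszul_diff v M = kdiff ksign v M" .
qed

lemma koszul_diff_apply: "koszul_diff v M = (\<Sum>j\<in>-M. ksign M j * var j * v (insert j M))"
  by (simp add: koszul_diff_eq kdiff_def)

lemma module_hom_koszul_diff: "module_hom smult smult koszul_diff"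
  by (simp add: koszul_diff_eq module_hom_kdiff)

interpretation kd: module_hom smult smult koszul_diff
  by (rule module_hom_koszul_diff)

lemma koszul_diff_diff: "koszul_diff (koszul_diff v) = 0"
  by (simp add: koszul_diff_eq kdiff_kdiff sign_system_ksign)

text \<open>
  The transpose of the Koszul differential: a functional is represented by the family of its values
  on the \<open>e\<^sub>M\<close>, and \<open>kdual \<psi> J\<close> is the value of \<open>\<psi> \<circ> \<partial>\<close> at \<open>e\<^sub>J\<close>.
\<close>

definition kdual :: "('n::{finite,linorder} set \<Rightarrow> ('n, 'k::field) mpoly) \<Rightarrow> 'n set \<Rightarrow> ('n, 'k) mpoly" where
  "kdual \<psi> J = (\<Sum>i\<in>J. ksign (J - {i}) i * var i * \<psi> (J - {i}))"

text \<open>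
  Reindexing by complements turns the dual complex into a Koszul complex for another
  system of signs.
\<close>

lemma kdual_exact:
  assumes cyc: "kdual \<psi> = 0" and top: "\<psi> UNIV = 0"
  shows "\<exists>\<theta>. kdual \<theta> = \<psi>"
proof -
  let ?s = "\<lambda>M j. ksign (- insert j M) j"
  have compl: "kdual \<theta> J = kdiff ?s (\<lambda>M. \<theta> (- M)) (- J)" for \<theta> J
    unfolding kdual_def kdiff_def
    by (rule sum.cong) (auto simp: Compl_insert)
  have "kdiff ?s (\<lambda>M. \<psi> (- M)) = 0"
  proof
    fix M
    show "kdiff ?s (\<lambda>M. \<psi> (- M)) M = 0 M"
      using compl[of \<psi> "- M"] by (simp add: cyc)
  qed
  then obtain w where w: "kdiff ?s w = (\<lambda>M. \<psi> (- M))"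
    using kdiff_exact[OF sign_system_dual_ksign, of "\<lambda>M. \<psi> (- M)"] top by auto
  have "kdual (\<lambda>J. w (- J)) = \<psi>"
    by (rule ext) (simp add: compl w)
  then show ?thesis by blast
qed

section \<open>Graded pieces of the Koszul complex\<close>

lemma carr_koszul: "carr (koszul j) = {v. \<forall>J. card J \<noteq> j \<longrightarrow> v J = 0}"
  by (simp add: koszul_def free_gmod_def)

lemma carr_koszul_supp_in: "carr (koszul j) = supp_in {J. card J = j}"
  by (simp add: carr_koszul supp_in_def)

lemma act_koszul [simp]: "act (koszul j) = smult"
  by (simp add: koszul_def free_gmod_def)

lemma hpart_koszul:
  "hpart (koszul j) d = {v \<in> carr (koszul j). \<forall>J. v J \<in> homog (d - int j)}"
  by (auto simp: koszul_def free_gmod_def shift_def ring_gmod_def homog_0)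

lemma carr_koszulI: "(\<And>J. card J \<noteq> j \<Longrightarrow> v J = 0) \<Longrightarrow> v \<in> carr (koszul j)"
  by (simp add: carr_koszul)

lemma carr_koszulD: "v \<in> carr (koszul j) \<Longrightarrow> card J \<noteq> j \<Longrightarrow> v J = 0"
  by (simp add: carr_koszul)

lemma subspace_koszul: "fam.subspace (carr (koszul j))"
  by (rule fam.subspaceI) (auto simp: carr_koszul smult_def)

lemma basis_koszul: "card J = j \<Longrightarrow> basis J \<in> carr (koszul j)"
  by (auto simp: carr_koszul basis_def)

lemma koszul_diff_carr:
  assumes "v \<in> carr (koszul (Suc j))"
  shows "koszul_diff v \<in> carr (koszul j)"
  by (rule carr_koszulI)
    (auto simp: koszul_diff_apply intro!: sum.neutral carr_koszulD[OF assms])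

text \<open>
  The differential lowers cardinality by one, so a preimage of a family supported on the sets with
  \<open>j + 1\<close> elements may be truncated to the sets with \<open>j + 2\<close> elements.
\<close>

lemma koszul_exact:
  assumes "v \<in> carr (koszul (Suc j))" "koszul_diff v = 0"
  shows "v \<in> syz (Suc (Suc j))"
proof -
  have "v {} = 0" by (rule carr_koszulD[OF assms(1)]) simp
  then obtain w where w: "koszul_diff w = v"
    using kdiff_exact[OF sign_system_ksign] assms(2) by (auto simp: koszul_diff_eq)
  define w' where "w' J = (if card J = Suc (Suc j) then w J else 0)" for J
  have "koszul_diff w' M = v M" for M
  proof (cases "card M = Suc j")
    case True
    then have "koszul_diff w' M = koszul_diff w M"
      by (auto simp: koszul_diff_apply w'_def intro!: sum.cong)
    then show ?thesis by (simp add: w)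
  next
    case False
    then show ?thesis
      by (auto simp: koszul_diff_apply w'_def carr_koszulD[OF assms(1)] intro!: sum.neutral)
  qed
  then have "koszul_diff w' = v" by auto
  moreover have "w' \<in> carr (koszul (Suc (Suc j)))" by (simp add: carr_koszul w'_def)
  ultimately show ?thesis by (auto simp: syz_def)
qed

lemma syz_carr: "u \<in> syz (Suc j) \<Longrightarrow> u \<in> carr (koszul j)"
  by (auto simp: syz_def koszul_diff_carr)

lemma koszul_diff_syz: "u \<in> syz j \<Longrightarrow> koszul_diff u = 0"
  by (auto simp: syz_def koszul_diff_diff)

lemma subspace_syz: "fam.subspace (syz j)"
  unfolding syz_def by (rule kd.subspace_image[OF subspace_koszul])

lemma ksign_homog:
  fixes f :: "('n::{finite,linorder}, 'k::field) mpoly"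
  shows "ksign M j * f \<in> homog d \<longleftrightarrow> f \<in> homog d"
  by (rule disjE[OF ksign_cases[where 's = "('n, 'k) mpoly", of M j]])
    (simp_all add: homog_def keys_uminus)

lemma ksign_homog_comp:
  fixes f :: "('n::{finite,linorder}, 'k::field) mpoly"
  shows "homog_comp d (ksign M j * f) = ksign M j * homog_comp d f"
  by (rule disjE[OF ksign_cases[where 's = "('n, 'k) mpoly", of M j]])
    (simp_all add: homog_comp_uminus)

lemma koszul_diff_hpart:
  assumes "v \<in> hpart (koszul (Suc j)) d"
  shows "koszul_diff v \<in> hpart (koszul j) d"
proof -
  have "var i * v J \<in> homog (d - int j)" for i J
    using homog_mult[OF homog_var, of "v J" "d - int (Suc j)" i] assms
    by (auto simp: hpart_koszul algebra_simps)
  then show ?thesis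
    using assms
    by (auto simp: hpart_koszul koszul_diff_carr koszul_diff_apply mult.assoc ksign_homog
        intro!: homog_sum)
qed

text \<open>
  The differential is homogeneous, so it commutes with taking components of matching degrees.
\<close>

lemma syz_lift_homogeneous:
  assumes "u \<in> syz (Suc j)" "u \<in> hpart (koszul j) d"
  obtains v where "v \<in> hpart (koszul (Suc j)) d" "koszul_diff v = u"
proof -
  obtain w where w: "w \<in> carr (koszul (Suc j))" "koszul_diff w = u"
    using assms(1) by (auto simp: syz_def)
  define v where "v J = homog_comp (d - int (Suc j)) (w J)" for J
  have "koszul_diff v M = u M" for M
  proof -
    have "homog_comp (d - int j) (var i * w J) = var i * homog_comp (d - int (Suc j)) (w J)" for i J
      using homog_comp_var_mult[of "d - int (Suc j)" i "w J"] by simp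
    then have "koszul_diff v M = homog_comp (d - int j) (koszul_diff w M)"
      by (simp add: koszul_diff_apply v_def homog_comp_sum mult.assoc ksign_homog_comp del: of_nat_Suc)
    also have "\<dots> = homog_comp (d - int j) (u M)" by (simp add: w)
    also have "\<dots> = u M" using assms(2) by (auto simp: hpart_koszul intro: homog_comp_id)
    finally show ?thesis .
  qed
  moreover have "v \<in> hpart (koszul (Suc j)) d"
    using w(1) by (auto simp: hpart_koszul carr_koszul v_def homog_comp_homog)
  ultimately show ?thesis using that by blast
qed

section \<open>The module \<open>\<^bold>A\<close>\<close>

text \<open>
  \<open>\<^bold>A\<close> consists of the functionals that factor through \<open>\<partial>\<close>: up to a sign that depends on \<open>M\<close> only,
  \<open>A_gen (- M)\<close> is \<open>e\<^sub>M\<^sup>* \<circ> \<partial>\<close>.  For \<open>L = - M\<close> the two signs attached to \<open>i \<in> L\<close> have total exponent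
  \<open>|L| + 1\<close> plus the number of inversions between \<open>L - {i}\<close> and \<open>M\<close>; compared with the inversions
  between \<open>L\<close> and \<open>M\<close>, this lacks the number of \<open>k \<in> M\<close> below \<open>i\<close>, which is the exponent in the
  differential.
\<close>

lemma A_gen_eq_koszul_diff:
  fixes M :: "'n::{finite,linorder} set"
  shows "\<exists>\<epsilon>. \<epsilon> * \<epsilon> = 1 \<and>
    (\<forall>v. A_gen (- M) v = \<epsilon> * (koszul_diff v M :: ('n, 'k::field) mpoly))"
proof -
  let ?L = "- M"
  let ?inv = "card {(j, k). j \<in> ?L \<and> k \<in> M \<and> j > k}"
  define \<epsilon> :: "('n, 'k) mpoly" where "\<epsilon> = (-1) ^ (card ?L + 1 + ?inv)"
  have sgn: "(-1) ^ (card {l \<in> ?L. l \<le> i} + 1) * shuffle_sign (?L - {i}) ((UNIV - ?L) \<union> {i}) =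
      \<epsilon> * ksign M i" if "i \<notin> M" for i
  proof -
    let ?C = "{(j, k). j \<in> ?L - {i} \<and> k \<in> M \<and> j > k}"
    let ?S = "{(j, k). j \<in> ?L - {i} \<and> k \<in> (UNIV - ?L) \<union> {i} \<and> j > k}"
    let ?I = "{(j, k). j \<in> ?L \<and> k \<in> M \<and> j > k}"
    let ?U = "{l \<in> ?L. l > i}" and ?D = "{k \<in> M. k < i}"
    have "?S = ?C \<union> (\<lambda>j. (j, i)) ` ?U" by auto
    moreover have "?C \<inter> (\<lambda>j. (j, i)) ` ?U = {}" using that by auto
    ultimately have "card ?S = card ?C + card ((\<lambda>j. (j, i)) ` ?U)"
      by (metis (no_types, lifting) card_Un_disjoint finite_code)
    then have S: "card ?S = card ?C + card ?U"
      by (simp add: card_image inj_on_def)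
    have "?I = ?C \<union> (\<lambda>k. (i, k)) ` ?D" using that by auto
    moreover have "?C \<inter> (\<lambda>k. (i, k)) ` ?D = {}" by auto
    ultimately have "card ?I = card ?C + card ((\<lambda>k. (i, k)) ` ?D)"
      by (metis (no_types, lifting) card_Un_disjoint finite_code)
    then have I: "card ?I = card ?C + card ?D"
      by (simp add: card_image inj_on_def)
    have "?L = {l \<in> ?L. l \<le> i} \<union> ?U" by auto
    moreover have "{l \<in> ?L. l \<le> i} \<inter> ?U = {}" by auto
    ultimately have L: "card ?L = card {l \<in> ?L. l \<le> i} + card ?U"
      by (metis (no_types, lifting) card_Un_disjoint finite_code)
    have "card {l \<in> ?L. l \<le> i} + 1 + card ?S = card ?L + 1 + card ?C"
      unfolding S using L by linarith
    then have "(-1) ^ (card {l \<in> ?L. l \<le> i} + 1) * (-1) ^ card ?S =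
        ((-1) ^ (card ?L + 1 + card ?C) :: ('n, 'k) mpoly)"
      by (simp only: flip: power_add)
    also have "\<dots> = (-1) ^ (card ?L + 1 + card ?I) * (-1) ^ card ?D"
      unfolding I by (simp add: power_add mult.assoc flip: power_mult_distrib)
    finally show ?thesis
      unfolding shuffle_sign_def \<epsilon>_def ksign_def .
  qed
  have "A_gen ?L v = \<epsilon> * koszul_diff v M" for v
  proof -
    have "A_gen ?L v = (\<Sum>i\<in>-M. (-1) ^ (card {l \<in> ?L. l \<le> i} + 1) *
        shuffle_sign (?L - {i}) ((UNIV - ?L) \<union> {i}) * var i * v ((UNIV - ?L) \<union> {i}))"
      by (simp add: A_gen_def sum_fun_apply smult_def dual_basis_def)
    also have "\<dots> = (\<Sum>i\<in>-M. \<epsilon> * ksign M i * var i * v (insert i M))"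
    proof (intro sum.cong refl)
      fix i assume "i \<in> - M"
      then have "i \<notin> M" by simp
      have ins: "(UNIV - ?L) \<union> {i} = insert i M" by auto
      show "(-1) ^ (card {l \<in> ?L. l \<le> i} + 1) *
          shuffle_sign (?L - {i}) ((UNIV - ?L) \<union> {i}) * var i * v ((UNIV - ?L) \<union> {i}) =
          \<epsilon> * ksign M i * var i * v (insert i M)"
        unfolding sgn[OF \<open>i \<notin> M\<close>] unfolding ins by (rule refl)
    qed
    finally show ?thesis
      by (simp add: koszul_diff_apply sum_distrib_left mult.assoc)
  qed
  moreover have "\<epsilon> * \<epsilon> = 1"
    unfolding \<epsilon>_def by (rule minus_one_mult_self)
  ultimately show ?thesis by blast
qed

lemma koszul_diff_in_A_mod:
  fixes M :: "'n::{finite,linorder} set"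
  assumes "card M = t"
  shows "(\<lambda>v. koszul_diff v M :: ('n, 'k::field) mpoly) \<in> A_mod t"
proof -
  obtain \<epsilon> :: "('n, 'k) mpoly" where \<epsilon>: "\<epsilon> * \<epsilon> = 1" "\<And>v. A_gen (- M) v = \<epsilon> * koszul_diff v M"
    using A_gen_eq_koszul_diff by blast
  have "card (- M) = CARD('n) - t"
    using assms by (simp add: Compl_eq_Diff_UNIV card_Diff_subset)
  then have "A_gen (- M) \<in> (A_mod t :: (('n set \<Rightarrow> ('n, 'k) mpoly) \<Rightarrow> _) set)"
    unfolding A_mod_def by (intro fam.span_base) blast
  then have "smult \<epsilon> (A_gen (- M)) \<in> (A_mod t :: (('n set \<Rightarrow> ('n, 'k) mpoly) \<Rightarrow> _) set)"
    unfolding A_mod_def by (rule fam.span_scale)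
  moreover have "smult \<epsilon> (A_gen (- M)) = (\<lambda>v. koszul_diff v M)"
    by (rule ext) (simp add: smult_def \<epsilon>(2) \<epsilon>(1) flip: mult.assoc)
  ultimately show ?thesis by simp
qed

text \<open>
  A functional on \<open>K\<^bsub>t+1\<^esub>\<close> that vanishes on boundaries is a cocycle of the dual complex, hence a
  coboundary; \<open>t + 1 < n\<close> keeps away from the only degree where the dual complex has
  cohomology.
\<close>

lemma functional_in_A_mod:
  fixes \<phi> :: "('n::{finite,linorder} set \<Rightarrow> ('n, 'k::field) mpoly) \<Rightarrow> ('n, 'k) mpoly"
  assumes hom: "module_hom smult (*) \<phi>"
    and van: "\<And>u. u \<in> syz (Suc (Suc t)) \<Longrightarrow> \<phi> u = 0"
    and t: "Suc t < CARD('n)"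
  shows "\<exists>\<phi>'\<in>A_mod t. \<forall>v\<in>carr (koszul (Suc t)). \<phi>' v = \<phi> v"
proof -
  define \<psi> where "\<psi> J = (if card J = Suc t then \<phi> (basis J) else 0)" for J
  have "kdual \<psi> J = 0" for J
  proof (cases "card J = Suc (Suc t)")
    case True
    have "koszul_diff (basis J :: 'n set \<Rightarrow> ('n, 'k) mpoly) = (\<Sum>i\<in>J. smult (ksign (J - {i}) i * var i) (basis (J - {i})))"
    proof
      fix M
      have "koszul_diff (basis J :: 'n set \<Rightarrow> ('n, 'k) mpoly) M = (\<Sum>j\<in>-M. if insert j M = J then ksign M j * var j else 0)"
        by (simp add: koszul_diff_apply basis_def)
          (intro sum.cong refl, auto)
      also have "\<dots> = (\<Sum>j\<in>J. if insert j M = J \<and> j \<notin> M then ksign M j * var j else 0)"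
        by (rule sum.mono_neutral_cong) auto
      also have "\<dots> = (\<Sum>i\<in>J. smult (ksign (J - {i}) i * var i) (basis (J - {i}))) M"
        unfolding sum_fun_apply smult_def basis_def by (intro sum.cong refl) auto
      finally show "koszul_diff (basis J :: 'n set \<Rightarrow> ('n, 'k) mpoly) M =
          (\<Sum>i\<in>J. smult (ksign (J - {i}) i * var i) (basis (J - {i}))) M" .
    qed
    then have "\<phi> (koszul_diff (basis J)) =
        (\<Sum>i\<in>J. ksign (J - {i}) i * var i * \<phi> (basis (J - {i})))"
      by (simp add: module_hom.sum[OF hom] module_hom.scale[OF hom])
    also have "\<dots> = kdual \<psi> J"
      unfolding kdual_def \<psi>_def using True by (intro sum.cong refl) auto
    finally show ?thesis
      using van[of "koszul_diff (basis J)"] basis_koszul[OF True] by (auto simp: syz_def)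
  next
    case False
    then show ?thesis
      unfolding kdual_def \<psi>_def
      by (intro sum.neutral) (auto simp: card_Suc_Diff1[symmetric] simp del: card_Diff_insert)
  qed
  then have "kdual \<psi> = 0" by (simp add: fun_eq_iff)
  moreover have "\<psi> UNIV = 0" using t by (simp add: \<psi>_def)
  ultimately obtain \<theta> where \<theta>: "kdual \<theta> = \<psi>"
    using kdual_exact by blast
  define \<phi>' where "\<phi>' = (\<Sum>M | card M = t. smult (\<theta> M) (\<lambda>v. koszul_diff v M))"
  have "\<phi>' \<in> A_mod t"
    unfolding \<phi>'_def A_mod_def
    by (intro fam.span_sum fam.span_scale) (use koszul_diff_in_A_mod in \<open>auto simp: A_mod_def\<close>)
  moreover have "\<phi>' v = \<phi> v" if v: "v \<in> carr (koszul (Suc t))" for v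
  proof -
    define c where "c M j = \<theta> M * (ksign M j * var j * v (insert j M))" for M and j :: 'n
    have "\<phi>' v = (\<Sum>M | card M = t. \<Sum>j\<in>-M. c M j)"
      by (simp add: \<phi>'_def sum_fun_apply smult_def koszul_diff_apply sum_distrib_left c_def)
    also have "\<dots> = (\<Sum>(M, j)\<in>Sigma {M. card M = t} (\<lambda>M. -M). c M j)"
      by (simp add: sum.Sigma)
    also have "\<dots> = (\<Sum>(J, i)\<in>Sigma {J. card J = Suc t} (\<lambda>J. J). c (J - {i}) i)"
      by (rule sum.reindex_bij_witness[where i = "\<lambda>(J, i). (J - {i}, i)" and j = "\<lambda>(M, j). (insert j M, j)"])
        (auto simp: insert_absorb)
    also have "\<dots> = (\<Sum>J | card J = Suc t. \<Sum>i\<in>J. c (J - {i}) i)"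
      by (simp add: sum.Sigma)
    also have "\<dots> = (\<Sum>J | card J = Suc t. v J * kdual \<theta> J)"
      unfolding kdual_def sum_distrib_left c_def
      by (intro sum.cong refl) (simp add: insert_absorb mult_ac)
    also have "\<dots> = (\<Sum>J | card J = Suc t. v J * \<phi> (basis J))"
      by (simp add: \<theta> \<psi>_def)
    also have "\<dots> = \<phi> v"
      using functional_expand[OF hom, of "{J. card J = Suc t}" v] v by (simp add: carr_koszul_supp_in)
    finally show ?thesis .
  qed
  ultimately show ?thesis by blast
qed

section \<open>Syzygy modules have no resolution of length one\<close>

lemma ksign_ord_ge:
  fixes f :: "('n::{finite,linorder}, 'k::field) mpoly"
  shows "ksign M j * f \<in> ord_ge k \<longleftrightarrow> f \<in> ord_ge k"
  by (rule disjE[OF ksign_cases[where 's = "('n, 'k) mpoly", of M j]])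
    (simp_all add: ord_ge_uminus)

lemma koszul_diff_ord_ge:
  "koszul_diff v M \<in> ord_ge 1"
proof -
  have "var i * v J \<in> ord_ge 1" for i J
    using ord_ge_mult[of "var i" 1 "v J" 0] by (simp add: ord_ge_var ord_ge_0)
  then show ?thesis
    by (auto simp: koszul_diff_apply mult.assoc ksign_ord_ge intro!: ord_ge_sum)
qed

lemma koszul_diff_basis:
  assumes "i \<in> J"
  shows "koszul_diff (basis J) (J - {i}) = ksign (J - {i}) i * var i"
proof -
  have "koszul_diff (basis J) (J - {i}) =
      (\<Sum>j\<in>-(J - {i}). if j = i then ksign (J - {i}) i * var i else 0)"
    unfolding koszul_diff_apply basis_def using assms by (intro sum.cong refl) auto
  then show ?thesis by simp
qed

text \<open>
  Suppose \<open>0 \<rightarrow> F \<rightarrow> G \<rightarrow> E\<^bsub>t+1\<^esub> \<rightarrow> 0\<close> is exact with \<open>F\<close> and \<open>G\<close> free.  Comparing it with the Koszul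
  resolution of \<open>E\<^bsub>t+1\<^esub>\<close> shows that the identity of \<open>K\<^bsub>t+2\<^esub>\<close> is homotopic to a
  map \<open>\<delta> \<eta>\<close> through \<open>F\<close>, up to a map \<open>T\<close> with image in \<open>E\<^bsub>t+3\<^esub> \<subseteq> \<mm> K\<^bsub>t+2\<^esub>\<close>.  On \<open>E\<^bsub>t+3\<^esub>\<close> both \<open>\<eta>\<close> and the
  homotopy vanish, so there \<open>T\<close> is the identity, which would put \<open>E\<^bsub>t+3\<^esub>\<close> into \<open>\<mm>\<^sup>2 K\<^bsub>t+2\<^esub>\<close>.  But the
  coefficients of \<open>\<partial> e\<^sub>J\<close> are variables.
\<close>

lemma syz_no_short_resolution:
  fixes f :: "('q \<Rightarrow> ('n::{finite,linorder}, 'k::field) mpoly) \<Rightarrow> 'n set \<Rightarrow> ('n, 'k) mpoly"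
    and \<alpha> :: "('p \<Rightarrow> ('n, 'k) mpoly) \<Rightarrow> 'q \<Rightarrow> ('n, 'k) mpoly"
  assumes \<alpha>: "module_hom smult smult \<alpha>" and P: "finite P"
    and \<alpha>inj: "\<And>x. x \<in> supp_in P \<Longrightarrow> \<alpha> x = 0 \<Longrightarrow> x = 0"
    and f: "module_hom smult smult f" and Q: "finite Q"
    and ker: "{g \<in> supp_in Q. f g = 0} = \<alpha> ` supp_in P"
    and img: "f ` supp_in Q = syz (Suc t)"
    and t: "t + 3 \<le> CARD('n)"
  shows False
proof -
  let ?C = "\<lambda>j. {J :: 'n set. card J = j}"
  let ?K = "\<lambda>j. carr (koszul j) :: ('n set \<Rightarrow> ('n, 'k) mpoly) set"
  interpret \<alpha>: module_hom smult smult \<alpha> by (rule \<alpha>)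
  interpret f: module_hom smult smult f by (rule f)
  have "\<exists>a\<in>?K (Suc t). koszul_diff a = f (basis x)" if "x \<in> Q" for x
  proof -
    have "f (basis x) \<in> syz (Suc t)" using img basis_supp_in[OF that] by blast
    then show ?thesis by (auto simp: syz_def)
  qed
  then obtain \<beta> where \<beta>: "module_hom smult smult \<beta>" "\<And>v. \<beta> v \<in> ?K (Suc t)"
    "\<And>v. v \<in> supp_in Q \<Longrightarrow> koszul_diff (\<beta> v) = f v"
    using free_lift[OF f module_hom_koszul_diff Q subspace_koszul] by metis
  have "\<exists>a\<in>supp_in Q. f a = koszul_diff (basis J)" if "J \<in> ?C (Suc t)" for J
  proof -
    have "koszul_diff (basis J) \<in> f ` supp_in Q"
      unfolding img syz_def using that by (auto intro: basis_koszul)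
    then show ?thesis by auto
  qed
  then obtain \<gamma> where \<gamma>: "module_hom smult smult \<gamma>" "\<And>v. \<gamma> v \<in> supp_in Q"
    "\<And>v. v \<in> ?K (Suc t) \<Longrightarrow> f (\<gamma> v) = koszul_diff v"
    using free_lift[OF module_hom_koszul_diff f _ subspace_supp_in, of "?C (Suc t)" Q]
    by (metis carr_koszul_supp_in finite_code)
  interpret \<beta>: module_hom smult smult \<beta> by (rule \<beta>(1))
  interpret \<gamma>: module_hom smult smult \<gamma> by (rule \<gamma>(1))
  have "\<exists>a\<in>supp_in P. \<alpha> a = \<gamma> (koszul_diff (basis J))" if "J \<in> ?C (Suc (Suc t))" for J
  proof -
    have "basis J \<in> ?K (Suc (Suc t))" using that by (auto intro: basis_koszul)
    then have "f (\<gamma> (koszul_diff (basis J))) = 0"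
      by (simp add: \<gamma>(3) koszul_diff_carr koszul_diff_diff)
    then have "\<gamma> (koszul_diff (basis J)) \<in> \<alpha> ` supp_in P"
      using \<gamma>(2) ker by blast
    then show ?thesis by auto
  qed
  then obtain \<eta> where \<eta>: "module_hom smult smult \<eta>" "\<And>v. \<eta> v \<in> supp_in P"
    "\<And>v. v \<in> ?K (Suc (Suc t)) \<Longrightarrow> \<alpha> (\<eta> v) = \<gamma> (koszul_diff v)"
    using free_lift[OF module_hom_comp[OF module_hom_koszul_diff \<gamma>(1)] \<alpha> _ subspace_supp_in,
        of "?C (Suc (Suc t))" P]
    by (metis carr_koszul_supp_in finite_code)
  have "\<exists>a\<in>?K (Suc (Suc t)). koszul_diff a = \<beta> (\<alpha> (basis x))" if "x \<in> P" for x
  proof -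
    have "\<alpha> (basis x) \<in> {g \<in> supp_in Q. f g = 0}" using ker basis_supp_in[OF that] by blast
    then have "koszul_diff (\<beta> (\<alpha> (basis x))) = 0" using \<beta>(3) by simp
    then have "\<beta> (\<alpha> (basis x)) \<in> syz (Suc (Suc t))" by (rule koszul_exact[OF \<beta>(2)])
    then show ?thesis by (metis imageE syz_def)
  qed
  then obtain \<delta> where \<delta>: "module_hom smult smult \<delta>" "\<And>v. \<delta> v \<in> ?K (Suc (Suc t))"
    "\<And>v. v \<in> supp_in P \<Longrightarrow> koszul_diff (\<delta> v) = \<beta> (\<alpha> v)"
    using free_lift[OF module_hom_comp[OF \<alpha> \<beta>(1)] module_hom_koszul_diff P subspace_koszul] by metis
  have "\<exists>a\<in>?K (Suc (Suc t)). koszul_diff a = basis J - \<beta> (\<gamma> (basis J))" if "J \<in> ?C (Suc t)" for J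
  proof -
    have J: "basis J \<in> ?K (Suc t)" using that by (auto intro: basis_koszul)
    then have "koszul_diff (basis J - \<beta> (\<gamma> (basis J))) = 0"
      by (simp add: kd.diff \<beta>(3) \<gamma>)
    moreover have "basis J - \<beta> (\<gamma> (basis J)) \<in> ?K (Suc t)"
      by (intro fam.subspace_diff[OF subspace_koszul] J \<beta>(2))
    ultimately have "basis J - \<beta> (\<gamma> (basis J)) \<in> syz (Suc (Suc t))" by (intro koszul_exact)
    then show ?thesis by (metis imageE syz_def)
  qed
  then obtain h where h: "module_hom smult smult h" "\<And>v. h v \<in> ?K (Suc (Suc t))"
    "\<And>v. v \<in> ?K (Suc t) \<Longrightarrow> koszul_diff (h v) = v - \<beta> (\<gamma> v)"
    using free_lift[OF module_hom_minus[OF module_hom_ident module_hom_comp[OF \<gamma>(1) \<beta>(1)]]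
        module_hom_koszul_diff _ subspace_koszul, of "?C (Suc t)" "Suc (Suc t)"]
    by (metis carr_koszul_supp_in finite_code)
  interpret \<delta>: module_hom smult smult \<delta> by (rule \<delta>(1))
  interpret h: module_hom smult smult h by (rule h(1))
  define T where "T w = w - \<delta> (\<eta> w) - h (koszul_diff w)" for w
  have T: "module_hom smult smult T"
    unfolding T_def
    by (intro module_hom_minus module_hom_comp[OF \<eta>(1) \<delta>(1)]
        module_hom_comp[OF module_hom_koszul_diff h(1)] module_hom_ident)
  have T1: "T w M \<in> ord_ge 1" if "w \<in> ?K (Suc (Suc t))" for w M
  proof -
    have "koszul_diff (T w) = 0"
      by (simp add: T_def kd.diff \<delta>(3) \<eta> that h(3) koszul_diff_carr)
    moreover have "T w \<in> ?K (Suc (Suc t))"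
      unfolding T_def by (intro fam.subspace_diff[OF subspace_koszul] that \<delta>(2) h(2))
    ultimately have "T w \<in> syz (Suc (Suc (Suc t)))" by (intro koszul_exact)
    then show ?thesis by (metis imageE syz_def koszul_diff_ord_ge)
  qed
  obtain J :: "'n set" where J: "card J = t + 3"
    using obtain_subset_with_card_n[OF t] by blast
  define w where "w = koszul_diff (basis J :: 'n set \<Rightarrow> ('n, 'k) mpoly)"
  have w: "w \<in> ?K (Suc (Suc t))" "koszul_diff w = 0"
    unfolding w_def using J
    by (auto intro!: koszul_diff_carr basis_koszul simp: koszul_diff_diff)
  have "\<alpha> (\<eta> w) = 0" by (simp only: \<eta>(3)[OF w(1)] w(2) \<gamma>.zero)
  then have "\<eta> w = 0" using \<alpha>inj \<eta>(2) by blast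
  then have Tw: "T w = w"
    by (simp only: T_def w(2) \<delta>.zero h.zero diff_zero)
  have T2: "T w M \<in> ord_ge 2" for M
  proof -
    have "w \<in> supp_in (?C (Suc (Suc t)))" using w(1) by (simp add: carr_koszul_supp_in)
    then have "T w M = (\<Sum>L\<in>?C (Suc (Suc t)). w L * T (basis L) M)"
      by (simp add: hom_eq_lin_ext[OF T, of "?C (Suc (Suc t))"] lin_ext_apply)
    moreover have "w L * T (basis L) M \<in> ord_ge (1 + 1)" if "L \<in> ?C (Suc (Suc t))" for L
      unfolding w_def using that
      by (intro ord_ge_mult koszul_diff_ord_ge T1) (auto intro: basis_koszul)
    ultimately show ?thesis
      by (auto simp: numeral_2_eq_2 intro!: ord_ge_sum)
  qed
  obtain i where i: "i \<in> J" using J by (metis card.empty ex_in_conv add_is_0 zero_neq_numeral)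
  have "w (J - {i}) \<in> ord_ge 2"
    using T2[of "J - {i}"] by (simp only: Tw)
  then show False
    by (simp add: w_def koszul_diff_basis[OF i] ksign_ord_ge ord_ge_var)
qed

section \<open>Rank count\<close>

lemma card_sets_containing:
  fixes i0 :: "'n::finite"
  shows "card {J :: 'n set. card J = Suc t \<and> i0 \<in> J} = (CARD('n) - 1) choose t"
proof -
  have "bij_betw (insert i0) {M. M \<subseteq> UNIV - {i0} \<and> card M = t} {J. card J = Suc t \<and> i0 \<in> J}"
    by (rule bij_betw_byWitness[where f' = "\<lambda>J. J - {i0}"]) (auto simp: insert_absorb card_insert_if)
  then have "card {J :: 'n set. card J = Suc t \<and> i0 \<in> J} = card {M. M \<subseteq> UNIV - {i0} \<and> card M = t}"
    by (rule bij_betw_same_card[symmetric])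
  then show ?thesis by (simp add: n_subsets)
qed

text \<open>
  The next lemmas determine the rank of \<open>E\<^bsub>t+1\<^esub>\<close>.  For \<open>u \<in> E\<^bsub>t+1\<^esub>\<close> the homotopy writes \<open>x\<^sub>i u\<close> as the
  boundary of a combination of those \<open>e\<^sub>J\<close> with \<open>i \<in> J\<close>, and the boundaries of these \<open>e\<^sub>J\<close> are
  linearly independent.  So the rank is the number of such \<open>J\<close> with \<open>t + 1\<close> elements, which is
  \<open>(n - 1) choose t\<close>.
\<close>

lemma khom_id:
  "koszul_diff (khom ksign id i v) + khom ksign id i (koszul_diff v) = smult (var i) v"
  by (rule ext)
    (use koszul_homotopy[OF sign_system_ksign, of id i v] in \<open>simp add: koszul_diff_eq smult_def\<close>)

lemma khom_id_supp_in:
  assumes "u \<in> carr (koszul t)"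
  shows "khom ksign id i u \<in> supp_in {J. card J = Suc t \<and> i \<in> J}"
proof (rule supp_inI)
  fix J assume J: "J \<notin> {J. card J = Suc t \<and> i \<in> J}"
  show "khom ksign id i u J = 0"
  proof (cases "i \<in> J")
    case True
    then have "card J = Suc (card (J - {i}))" by (simp only: card.remove finite)
    then have "card (J - {i}) \<noteq> t" using J True by auto
    then have "u (J - {i}) = 0" by (rule carr_koszulD[OF assms])
    then show ?thesis by (simp add: khom_def)
  qed (simp add: khom_def)
qed

lemma khom_id_0: "khom ksign id i 0 = 0"
  by (simp add: khom_def fun_eq_iff)

lemma koszul_cone_injective:
  fixes s :: "'n::{finite,linorder} set \<Rightarrow> ('n, 'k::field) mpoly"
  assumes "s \<in> supp_in {J. card J = Suc t \<and> i \<in> J}" "koszul_diff s = 0"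
  shows "s = 0"
proof -
  have "khom ksign id i s = 0"
    using supp_inD[OF assms(1)] by (auto simp: khom_def fun_eq_iff)
  then have "smult (var i) s = 0"
    using khom_id[of i s] by (simp add: assms(2) kd.zero khom_id_0 del: id_apply)
  then show ?thesis by (simp add: smult_def fun_eq_iff var_nonzero)
qed

text \<open>
  The equation \<open>rank F + rank E\<^bsub>t+1\<^esub> = rank G + 1\<close> for an exact sequence
  \<open>0 \<rightarrow> F \<rightarrow> G \<rightarrow> E\<^bsub>t+1\<^esub> \<rightarrow> S\<close> whose last map is nonzero.  The last map is given by \<open>\<phi>\<close>, its composite
  with \<open>\<partial>\<close>.  It takes the value \<open>a = \<phi> v\<^sub>0\<close> at \<open>\<partial> v\<^sub>0\<close>, so \<open>a \<partial> s - \<phi>(s) \<partial> v\<^sub>0\<close> is in its kernel and lifts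
  to \<open>\<gamma> s \<in> G\<close>; this splits the sequence after inverting \<open>a\<close>.
\<close>

lemma bourbaki_rank:
  fixes f :: "('q \<Rightarrow> ('n::{finite,linorder}, 'k::field) mpoly) \<Rightarrow> 'n set \<Rightarrow> ('n, 'k) mpoly"
    and \<alpha> :: "('p \<Rightarrow> ('n, 'k) mpoly) \<Rightarrow> 'q \<Rightarrow> ('n, 'k) mpoly"
  assumes \<alpha>: "module_hom smult smult \<alpha>" and P: "finite P"
    and \<alpha>inj: "\<And>x. x \<in> supp_in P \<Longrightarrow> \<alpha> x = 0 \<Longrightarrow> x = 0"
    and f: "module_hom smult smult f" and Q: "finite Q"
    and ker: "{g \<in> supp_in Q. f g = 0} = \<alpha> ` supp_in P"
    and \<phi>: "module_hom smult (*) \<phi>" and \<phi>syz: "\<And>u. u \<in> syz (Suc (Suc t)) \<Longrightarrow> \<phi> u = 0"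
    and img: "f ` supp_in Q = koszul_diff ` {v \<in> carr (koszul (Suc t)). \<phi> v = 0}"
    and v0: "v0 \<in> carr (koszul (Suc t))" "\<phi> v0 \<noteq> 0"
  shows "card P + ((CARD('n) - 1) choose t) = card Q + 1"
proof -
  let ?K = "carr (koszul (Suc t)) :: ('n set \<Rightarrow> ('n, 'k) mpoly) set"
  note \<phi>_add = module_hom.add[OF \<phi>] and \<phi>_scale = module_hom.scale[OF \<phi>]
    and \<phi>_diff = module_hom.diff[OF \<phi>]
  interpret \<alpha>: module_hom smult smult \<alpha> by (rule \<alpha>)
  interpret f: module_hom smult smult f by (rule f)
  obtain i0 :: 'n where True by blast
  define N where "N = {J :: 'n set. card J = Suc t \<and> i0 \<in> J}"
  define a where "a = \<phi> v0"
  have NK: "s \<in> ?K" if "s \<in> supp_in N" for s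
    using that by (auto simp: carr_koszul_supp_in N_def supp_in_def)
  have \<tau>: "module_hom smult smult (\<lambda>s. smult a (koszul_diff s) - smult (\<phi> s) (koszul_diff v0))"
    by (auto simp: module_hom_iff module_smult kd.add kd.scale fam.scale_right_distrib \<phi>_add \<phi>_scale
        fam.scale_left_distrib fam.scale_right_diff_distrib mult.commute)
  have "\<exists>g\<in>supp_in Q. f g = smult a (koszul_diff (basis J)) - smult (\<phi> (basis J)) (koszul_diff v0)"
    if "J \<in> N" for J
  proof -
    define w where "w = smult a (basis J) - smult (\<phi> (basis J)) v0"
    have "w \<in> ?K"
      unfolding w_def using that
      by (intro fam.subspace_diff[OF subspace_koszul] fam.subspace_scale[OF subspace_koszul] v0 NK
          basis_supp_in)
    moreover have "\<phi> w = 0"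
      by (simp add: w_def \<phi>_diff \<phi>_scale a_def mult.commute)
    ultimately have "koszul_diff w \<in> f ` supp_in Q" unfolding img by blast
    then show ?thesis by (auto simp: w_def kd.diff kd.scale)
  qed
  then obtain \<gamma> where \<gamma>: "module_hom smult smult \<gamma>" "\<And>s. \<gamma> s \<in> supp_in Q"
    "\<And>s. s \<in> supp_in N \<Longrightarrow> f (\<gamma> s) = smult a (koszul_diff s) - smult (\<phi> s) (koszul_diff v0)"
    using free_lift[OF \<tau> f _ subspace_supp_in, of N Q] by (metis (no_types, lifting) finite_code)
  interpret \<gamma>: module_hom smult smult \<gamma> by (rule \<gamma>(1))
  \<comment> \<open>the map \<open>F \<oplus> S\<^bsup>N\<^esup> \<rightarrow> G \<oplus> S\<close> that becomes an isomorphism over the fraction field\<close>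
  define \<Phi> :: "('p + 'n set \<Rightarrow> ('n, 'k) mpoly) \<Rightarrow> ('q + unit \<Rightarrow> ('n, 'k) mpoly)" where
    "\<Phi> w = case_sum (\<alpha> (\<lambda>i. w (Inl i)) + \<gamma> (\<lambda>J. w (Inr J))) (\<lambda>_. \<phi> (\<lambda>J. w (Inr J)))" for w
  let ?X = "P <+> N" and ?Y = "Q <+> (UNIV :: unit set)"
  have parts: "(\<lambda>i. w (Inl i)) \<in> supp_in P" "(\<lambda>J. w (Inr J)) \<in> supp_in N" if "w \<in> supp_in ?X" for w
    using that by (auto simp: supp_in_def)
  have \<alpha>Q: "\<alpha> x \<in> supp_in Q" "f (\<alpha> x) = 0" if "x \<in> supp_in P" for x
    using ker that by blast+
  have "card ?X = card ?Y"
  proof (rule card_eq_of_generic_iso[where \<Phi> = \<Phi> and r = "var i0 * a"])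
    show "module_hom smult smult \<Phi>"
    proof -
      have "\<Phi> (u + w) = \<Phi> u + \<Phi> w" for u w
      proof -
        have "(\<lambda>i. (u + w) (Inl i)) = (\<lambda>i. u (Inl i)) + (\<lambda>i. w (Inl i))"
          "(\<lambda>J. (u + w) (Inr J)) = (\<lambda>J. u (Inr J)) + (\<lambda>J. w (Inr J))"
          by (simp_all add: fun_eq_iff)
        then show ?thesis
          unfolding \<Phi>_def \<alpha>.add \<gamma>.add \<phi>_add
          by (simp only: \<alpha>.add \<gamma>.add \<phi>_add) (auto simp: fun_eq_iff algebra_simps split: sum.split)
      qed
      moreover have "\<Phi> (smult r w) = smult r (\<Phi> w)" for r w
      proof -
        have "(\<lambda>i. smult r w (Inl i)) = smult r (\<lambda>i. w (Inl i))"
          "(\<lambda>J. smult r w (Inr J)) = smult r (\<lambda>J. w (Inr J))"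
          by (simp_all add: fun_eq_iff smult_def)
        then show ?thesis
          unfolding \<Phi>_def
          by (simp only: \<alpha>.scale \<gamma>.scale \<phi>_scale)
            (auto simp: fun_eq_iff smult_def distrib_left split: sum.split)
      qed
      ultimately show ?thesis by (simp add: module_hom_iff module_smult)
    qed
    show "\<Phi> w \<in> supp_in ?Y" if "w \<in> supp_in ?X" for w
      using \<alpha>Q(1)[OF parts(1)[OF that]] \<gamma>(2)[of "\<lambda>J. w (Inr J)"]
      by (fastforce simp: \<Phi>_def supp_in_def split: sum.splits)
    show "w = 0" if w: "w \<in> supp_in ?X" and 0: "\<Phi> w = 0" for w
    proof -
      define x s where "x = (\<lambda>i. w (Inl i))" and "s = (\<lambda>J. w (Inr J))"
      have x: "x \<in> supp_in P" and s: "s \<in> supp_in N" using parts[OF w] by (auto simp: x_def s_def)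
      have \<phi>s: "\<phi> s = 0" using fun_cong[OF 0, of "Inr ()"] by (simp add: \<Phi>_def s_def)
      have G: "\<alpha> x + \<gamma> s = 0"
      proof
        fix k show "(\<alpha> x + \<gamma> s) k = 0 k"
          using fun_cong[OF 0, of "Inl k"] by (simp add: \<Phi>_def s_def x_def)
      qed
      have "f (\<alpha> x + \<gamma> s) = smult a (koszul_diff s)"
        by (simp only: f.add \<alpha>Q(2)[OF x] \<gamma>(3)[OF s] \<phi>s) simp
      then have "smult a (koszul_diff s) = 0" by (simp only: G f.zero)
      then have "koszul_diff s = 0"
        using v0(2) by (simp add: a_def smult_def fun_eq_iff)
      then have s0: "s = 0" using koszul_cone_injective s unfolding N_def by blast
      then have "\<alpha> x = 0" using G by (simp only: \<gamma>.zero) simp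
      then have "x = 0" using \<alpha>inj x by blast
      then have "w (Inl i) = 0" "w (Inr J) = 0" for i J
        using s0 by (simp_all add: x_def s_def fun_eq_iff)
      then show ?thesis by (simp add: fun_eq_iff split_sum_all)
    qed
    show "var i0 * a \<noteq> 0" using v0(2) by (simp add: a_def var_nonzero)
    show "\<exists>w\<in>supp_in ?X. \<Phi> w = smult (var i0 * a) (basis y)" if "y \<in> ?Y" for y
    proof -
      define g \<sigma> where "g = (\<lambda>k. (basis y :: _ \<Rightarrow> ('n, 'k) mpoly) (Inl k))"
        and "\<sigma> = (basis y :: _ \<Rightarrow> ('n, 'k) mpoly) (Inr ())"
      have g: "g \<in> supp_in Q" using that by (auto simp: g_def supp_in_def basis_def)
      obtain v1 where v1: "v1 \<in> ?K" "\<phi> v1 = 0" "koszul_diff v1 = f g"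
      proof -
        have "f g \<in> koszul_diff ` {v \<in> ?K. \<phi> v = 0}" using img g by blast
        then show thesis using that by auto
      qed
      define v where "v = v1 + smult \<sigma> v0"
      define s where "s = khom ksign id i0 (koszul_diff v)"
      have v: "v \<in> ?K" unfolding v_def
        by (intro fam.subspace_add[OF subspace_koszul] fam.subspace_scale[OF subspace_koszul] v0 v1)
      have s: "s \<in> supp_in N"
        unfolding s_def N_def by (intro khom_id_supp_in koszul_diff_carr v)
      have ds: "koszul_diff s = smult (var i0) (koszul_diff v)"
        using arg_cong[OF khom_id[of i0 v], of koszul_diff]
        by (simp add: kd.add kd.scale koszul_diff_diff s_def)
      have "s - smult (var i0) v \<in> syz (Suc (Suc t))"
      proof (rule koszul_exact)
        show "s - smult (var i0) v \<in> ?K"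
          by (intro fam.subspace_diff[OF subspace_koszul] fam.subspace_scale[OF subspace_koszul]
              NK s v)
        show "koszul_diff (s - smult (var i0) v) = 0"
          by (simp only: kd.diff kd.scale ds) simp
      qed
      then have "\<phi> s = \<phi> (smult (var i0) v)" using \<phi>syz \<phi>_diff by fastforce
      then have \<phi>s: "\<phi> s = var i0 * a * \<sigma>"
        by (simp add: v_def \<phi>_add \<phi>_scale v1 a_def mult_ac)
      have "f (smult (var i0 * a) g - \<gamma> s) = 0"
        unfolding f.diff f.scale \<gamma>(3)[OF s] \<phi>s ds v_def kd.add kd.scale v1(3)
        by (simp add: smult_def fun_eq_iff algebra_simps)
      moreover have "smult (var i0 * a) g - \<gamma> s \<in> supp_in Q"
        by (intro fam.subspace_diff[OF subspace_supp_in] fam.subspace_scale[OF subspace_supp_in] g \<gamma>(2))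
      ultimately have "smult (var i0 * a) g - \<gamma> s \<in> \<alpha> ` supp_in P"
        unfolding ker[symmetric] by simp
      then obtain x where x: "x \<in> supp_in P" "\<alpha> x = smult (var i0 * a) g - \<gamma> s"
        by (metis imageE)
      have "\<Phi> (case_sum x s) = smult (var i0 * a) (basis y)"
      proof -
        have "\<Phi> (case_sum x s) = case_sum (\<alpha> x + \<gamma> s) (\<lambda>_. \<phi> s)"
          by (simp add: \<Phi>_def)
        also have "\<dots> = case_sum (smult (var i0 * a) g) (\<lambda>_. var i0 * a * \<sigma>)"
          unfolding x(2) \<phi>s by (simp only: diff_add_cancel)
        also have "\<dots> = smult (var i0 * a) (basis y)"
          by (rule ext) (auto simp: g_def \<sigma>_def smult_def split: sum.split)
        finally show ?thesis .
      qed
      moreover have "case_sum x s \<in> supp_in ?X"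
        using x(1) s by (auto simp: supp_in_def split: sum.split)
      ultimately show ?thesis by blast
    qed
  qed (use P Q in \<open>auto simp: finite_Plus\<close>)
  moreover have "card ?X = card P + ((CARD('n) - 1) choose t)"
    using P card_sets_containing[of t i0] by (simp add: card_Plus N_def)
  moreover have "card ?Y = card Q + 1"
    using Q by (simp add: card_Plus)
  ultimately show ?thesis by simp
qed

section \<open>Long Bourbaki sequences\<close>

lemma gsub_simps [simp]:
  "act (gsub M N) = act M" "carr (gsub M N) = N" "hpart (gsub M N) i = N \<inter> hpart M i"
  by (simp_all add: gsub_def)

lemma shift_simps [simp]:
  "act (shift d M) = act M" "carr (shift d M) = carr M" "hpart (shift d M) i = hpart M (d + i)"
  by (simp_all add: shift_def)

lemma ring_gmod_simps [simp]:
  "act ring_gmod = (*)" "carr ring_gmod = UNIV" "hpart ring_gmod = homog"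
  by (simp_all add: ring_gmod_def)

lemma syz_gmod_Suc: "syz_gmod (Suc t) = gsub (koszul t) (syz (Suc t))"
  by (simp add: syz_gmod_def)

lemma gsub_shift_eq:
  "gsub ring_gmod I = shift (- c) (gsub (shift c ring_gmod) I)"
  by (simp add: gsub_def shift_def ring_gmod_def)

lemma ghomD:
  assumes "ghom d M N f"
  shows "u \<in> carr M \<Longrightarrow> f u \<in> carr N"
    and "u \<in> carr M \<Longrightarrow> v \<in> carr M \<Longrightarrow> f (u + v) = f u + f v"
    and "u \<in> carr M \<Longrightarrow> f (act M r u) = act N r (f u)"
    and "u \<in> hpart M i \<Longrightarrow> f u \<in> hpart N (i + d)"
  using assms by (auto simp: ghom_def)

lemma ghom_zero:
  assumes "ghom d M N f" "0 \<in> carr M"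
  shows "f 0 = 0"
  using ghomD(2)[OF assms(1,2,2)] by (metis add.right_neutral add_left_cancel)

lemma basis_hpart: "x \<in> X \<Longrightarrow> basis x \<in> hpart (free_gmod X w) (w x)"
  by (auto simp: hpart_free supp_in_def basis_def homog_one homog_0)

lemma ghom_lin_ext:
  assumes "finite X" "\<And>x. x \<in> X \<Longrightarrow> b x \<in> hpart (koszul j) (w x)"
  shows "ghom 0 (free_gmod X w) (koszul j) (lin_ext X b)"
proof -
  interpret l: module_hom smult smult "lin_ext X b" by (rule module_hom_lin_ext)
  have carr: "lin_ext X b v \<in> carr (koszul j)" for v
    using assms by (intro lin_ext_in_subspace[OF subspace_koszul]) (auto simp: hpart_koszul)
  moreover have "lin_ext X b v J \<in> homog (d - int j)"
    if "v \<in> hpart (free_gmod X w) d" for v d J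
    unfolding lin_ext_apply
  proof (rule homog_sum)
    fix x assume x: "x \<in> X"
    have "v x * b x J \<in> homog ((d - w x) + (w x - int j))"
      using that x assms(2)[OF x] by (intro homog_mult) (auto simp: hpart_free hpart_koszul)
    then show "v x * b x J \<in> homog (d - int j)" by simp
  qed
  ultimately show ?thesis
    by (auto simp: ghom_def l.add l.scale hpart_koszul)
qed

text \<open>
  \<open>\<phi>\<close> is the composite \<open>\<pi> \<circ> \<partial>\<close>, and the \<open>\<beta>\<^sub>i\<close> are homogeneous preimages of the \<open>f g\<^sub>i\<close> under \<open>\<partial>\<close>.
  Since \<open>\<partial> \<circ> \<beta> = f\<close>, exactness of the sequence turns into statements about \<open>\<beta>\<close> modulo
  \<open>E\<^bsub>t+2\<^esub> = Ker \<partial>\<close>: the kernel of \<open>\<phi>\<close>, and the preimage \<open>\<alpha> F\<close> of \<open>E\<^bsub>t+2\<^esub>\<close> under \<open>\<beta>\<close>.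
\<close>

lemma bourbaki_sequence_imp_data:
  fixes I :: "('n::{finite,linorder}, 'k::field) mpoly set"
  assumes n: "CARD('n) \<ge> 4" and t: "t \<le> CARD('n) - 4"
    and lb: "long_bourbaki t c p a q b I \<alpha> f \<pi>" and nz: "\<forall>i\<in>{1..q}. f (basis i) \<noteq> 0"
  shows "\<exists>\<beta>s \<phi>. bourbaki_data t c p a q b \<beta>s \<phi> \<and> I = \<phi> ` carr (koszul (t + 1))"
proof -
  let ?K = "carr (koszul (Suc t)) :: ('n set \<Rightarrow> ('n, 'k) mpoly) set"
  let ?P = "{1..p}" and ?Q = "{1..q}"
  let ?F = "free_gmod ?P a :: (('n, 'k) mpoly, _) gmod"
  let ?G = "free_gmod ?Q b :: (('n, 'k) mpoly, _) gmod"
  have \<alpha>: "ghom 0 ?F ?G \<alpha>" and \<alpha>ker: "gker ?F \<alpha> = {0}"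
    and f: "ghom 0 ?G (syz_gmod (Suc t)) f"
    and \<pi>: "ghom 0 (syz_gmod (Suc t)) (shift c (gsub ring_gmod I)) \<pi>"
    and exG: "\<alpha> ` supp_in ?P = {g \<in> supp_in ?Q. f g = 0}"
    and exE: "f ` supp_in ?Q = {u \<in> syz (Suc t). \<pi> u = 0}"
    and \<pi>im: "\<pi> ` syz (Suc t) = I"
    using lb by (auto simp: long_bourbaki_def exact4_def gmono_def gker_def carr_free syz_gmod_Suc)
  have \<pi>I: "\<pi> u \<in> I" if "u \<in> syz (Suc t)" for u
    using \<pi>im that by blast
  have dK: "koszul_diff v \<in> syz (Suc t)" if "v \<in> ?K" for v
    using that by (auto simp: syz_def)

  \<comment> \<open>the functional \<open>\<pi> \<circ> \<partial>\<close>, first on \<open>K\<^bsub>t+1\<^esub>\<close> and then as a map defined everywhere\<close>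
  have \<pi>d: "ghom 0 (koszul (Suc t)) (shift c (gsub ring_gmod I)) (\<lambda>v. \<pi> (koszul_diff v))"
    unfolding ghom_def
  proof (intro conjI allI ballI)
    show "(\<lambda>v. \<pi> (koszul_diff v)) ` ?K \<subseteq> carr (shift c (gsub ring_gmod I))"
      using dK \<pi>I by auto
    show "\<pi> (koszul_diff (u + v)) = \<pi> (koszul_diff u) + \<pi> (koszul_diff v)"
      if "u \<in> ?K" "v \<in> ?K" for u v
      using ghomD(2)[OF \<pi>] dK that by (simp only: kd.add syz_gmod_Suc gsub_simps)
    show "\<pi> (koszul_diff (act (koszul (Suc t)) r u)) = act (shift c (gsub ring_gmod I)) r (\<pi> (koszul_diff u))"
      if "u \<in> ?K" for r u
      using ghomD(3)[OF \<pi>] dK[OF that] by (simp add: kd.scale syz_gmod_Suc)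
    show "\<pi> (koszul_diff u) \<in> hpart (shift c (gsub ring_gmod I)) (i + 0)"
      if "u \<in> hpart (koszul (Suc t)) i" for i u
      using ghomD(4)[OF \<pi>, of "koszul_diff u" i] koszul_diff_hpart[OF that] dK[of u] that
      by (simp add: syz_gmod_Suc hpart_koszul)
  qed
  define \<phi>0 where "\<phi>0 v = (\<Sum>J | card J = Suc t. v J * \<pi> (koszul_diff (basis J)))" for v
  have \<phi>0: "module_hom smult (*) \<phi>0"
    by (simp add: module_hom_iff module_smult module_times \<phi>0_def distrib_right sum.distrib
        smult_def sum_distrib_left mult.assoc)
  have \<phi>0\<pi>: "\<phi>0 v = \<pi> (koszul_diff v)" if "v \<in> ?K" for v
    using ghom_free_expand[OF \<pi>d[unfolded koszul_def]] that
    by (simp add: \<phi>0_def carr_koszul_supp_in)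
  have \<pi>0: "\<pi> 0 = 0"
    by (rule ghom_zero[OF \<pi>]) (simp add: syz_gmod_Suc fam.subspace_0[OF subspace_syz])
  have \<phi>0syz: "\<phi>0 u = 0" if "u \<in> syz (Suc (Suc t))" for u
    using \<phi>0\<pi>[OF syz_carr[OF that]] koszul_diff_syz[OF that] \<pi>0 by simp
  have "Suc t < CARD('n)" using n t by linarith
  then obtain \<phi> where \<phi>A: "\<phi> \<in> A_mod t" and \<phi>\<phi>0: "\<And>v. v \<in> ?K \<Longrightarrow> \<phi> v = \<phi>0 v"
    using functional_in_A_mod[OF \<phi>0 \<phi>0syz] by blast
  have \<phi>\<pi>: "\<phi> v = \<pi> (koszul_diff v)" if "v \<in> ?K" for v
    by (simp add: \<phi>\<phi>0 \<phi>0\<pi> that)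
  have \<phi>hom: "ghom (int CARD('n) + c) (koszul (Suc t)) (shift (- int CARD('n)) ring_gmod) \<phi>"
    unfolding ghom_def
  proof (intro conjI allI ballI)
    show "\<phi> ` ?K \<subseteq> carr (shift (- int CARD('n)) ring_gmod)" by simp
    show "\<phi> (u + v) = \<phi> u + \<phi> v" if "u \<in> ?K" "v \<in> ?K" for u v
      by (simp only: \<phi>\<phi>0 that fam.subspace_add[OF subspace_koszul] module_hom.add[OF \<phi>0])
    show "\<phi> (act (koszul (Suc t)) r u) = act (shift (- int CARD('n)) ring_gmod) r (\<phi> u)"
      if "u \<in> ?K" for r u
      by (simp add: \<phi>\<phi>0 that fam.subspace_scale[OF subspace_koszul] module_hom.scale[OF \<phi>0])
    show "\<phi> u \<in> hpart (shift (- int CARD('n)) ring_gmod) (i + (int CARD('n) + c))"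
      if "u \<in> hpart (koszul (Suc t)) i" for i u
      using ghomD(4)[OF \<pi>d that] that by (simp add: \<phi>\<pi> hpart_koszul add.commute)
  qed

  \<comment> \<open>homogeneous preimages of the generators\<close>
  have "\<exists>v\<in>hpart (koszul (Suc t)) (b i). koszul_diff v = f (basis i)" if "i \<in> ?Q" for i
    using ghomD(4)[OF f basis_hpart[OF that]] syz_lift_homogeneous
    by (metis Int_iff add.right_neutral gsub_simps(3) syz_gmod_Suc)
  then obtain \<beta>s where \<beta>s: "\<And>i. i \<in> ?Q \<Longrightarrow> \<beta>s i \<in> hpart (koszul (Suc t)) (b i)"
    and d\<beta>s: "\<And>i. i \<in> ?Q \<Longrightarrow> koszul_diff (\<beta>s i) = f (basis i)" by metis
  define \<beta> where "\<beta> = lin_ext ?Q \<beta>s"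
  interpret \<beta>: module_hom smult smult \<beta> unfolding \<beta>_def by (rule module_hom_lin_ext)
  have \<beta>hom: "ghom 0 ?G (koszul (Suc t)) \<beta>"
    unfolding \<beta>_def by (rule ghom_lin_ext) (auto intro: \<beta>s)
  have \<beta>K: "\<beta> g \<in> ?K" for g
    unfolding \<beta>_def using \<beta>s by (intro lin_ext_in_subspace[OF subspace_koszul]) (auto simp: hpart_koszul)
  define f' where "f' = lin_ext ?Q (\<lambda>i. f (basis i))"
  have f': "f g = f' g" if "g \<in> supp_in ?Q" for g
    using ghom_free_expand[OF f _ that] by (simp add: f'_def lin_ext_def syz_gmod_Suc)
  have d\<beta>: "koszul_diff (\<beta> g) = f g" if "g \<in> supp_in ?Q" for g
    unfolding f'[OF that] f'_def \<beta>_def hom_lin_ext[OF module_hom_koszul_diff]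
    by (rule lin_ext_cong) (rule d\<beta>s)
  define B where "B = fam.span (\<beta>s ` ?Q)"
  have B: "B = \<beta> ` supp_in ?Q"
    unfolding B_def \<beta>_def by (rule span_image_eq_lin_ext) simp
  have \<beta>s_notin: "\<beta>s i \<in> ?K - syz (Suc (Suc t))" if "i \<in> ?Q" for i
    using \<beta>s[OF that] d\<beta>s[OF that] nz that by (auto simp: hpart_koszul dest: koszul_diff_syz)

  have \<phi>ker: "gker (koszul (Suc t)) \<phi> = {u + v | u v. u \<in> B \<and> v \<in> syz (Suc (Suc t))}"
  proof safe
    fix u assume "u \<in> gker (koszul (Suc t)) \<phi>"
    then have u: "u \<in> ?K" "\<pi> (koszul_diff u) = 0" by (auto simp: gker_def \<phi>\<pi>)
    then have "koszul_diff u \<in> f ` supp_in ?Q" unfolding exE using dK by blast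
    then obtain g where g: "g \<in> supp_in ?Q" "koszul_diff u = f g" by blast
    have "koszul_diff (u - \<beta> g) = 0" by (simp only: kd.diff g(2) d\<beta>[OF g(1)]) simp
    then have "u - \<beta> g \<in> syz (Suc (Suc t))"
      by (intro koszul_exact fam.subspace_diff[OF subspace_koszul] u(1) \<beta>K)
    moreover have "\<beta> g \<in> B" unfolding B using g(1) by blast
    moreover have "u = \<beta> g + (u - \<beta> g)" by simp
    ultimately show "\<exists>u' v. u = u' + v \<and> u' \<in> B \<and> v \<in> syz (Suc (Suc t))" by blast
  next
    fix u v :: "'n set \<Rightarrow> ('n, 'k) mpoly"
    assume "u \<in> B" and v: "v \<in> syz (Suc (Suc t))"
    then obtain g where g: "g \<in> supp_in ?Q" "u = \<beta> g" unfolding B by blast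
    have "f g \<in> {u \<in> syz (Suc t). \<pi> u = 0}" using exE g(1) by blast
    moreover have uv: "u + v \<in> ?K"
      unfolding g(2) by (intro fam.subspace_add[OF subspace_koszul] \<beta>K syz_carr v)
    moreover have "koszul_diff (u + v) = f g"
      by (simp only: kd.add g(2) d\<beta>[OF g(1)] koszul_diff_syz[OF v]) simp
    ultimately show "u + v \<in> gker (koszul (Suc t)) \<phi>"
      by (simp add: gker_def \<phi>\<pi>)
  qed

  have pq: "int p = int q + 1 - int ((CARD('n) - 1) choose t)"
  proof -
    define \<alpha>' where "\<alpha>' = lin_ext ?P (\<lambda>i. \<alpha> (basis i))"
    have \<alpha>': "\<alpha> x = \<alpha>' x" if "x \<in> supp_in ?P" for x
      using ghom_free_expand[OF \<alpha> _ that] by (simp add: \<alpha>'_def lin_ext_def)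
    have inj: "x = 0" if "x \<in> supp_in ?P" "\<alpha>' x = 0" for x
    proof -
      have "x \<in> gker ?F \<alpha>" using that by (simp add: gker_def carr_free \<alpha>')
      then show ?thesis unfolding \<alpha>ker by simp
    qed
    have ker: "{g \<in> supp_in ?Q. f' g = 0} = \<alpha>' ` supp_in ?P"
      using exG by (simp add: f' \<alpha>' cong: conj_cong image_cong)
    have img: "f' ` supp_in ?Q = koszul_diff ` {v \<in> ?K. \<phi>0 v = 0}"
    proof -
      have "f' ` supp_in ?Q = {u \<in> syz (Suc t). \<pi> u = 0}"
        using exE by (simp add: f' cong: image_cong)
      also have "\<dots> = koszul_diff ` {v \<in> ?K. \<phi>0 v = 0}"
        by (auto simp: syz_def \<phi>0\<pi>)
      finally show ?thesis .
    qed
    have homs: "module_hom smult smult \<alpha>'" "module_hom smult smult f'"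
      unfolding \<alpha>'_def f'_def by (rule module_hom_lin_ext)+
    \<comment> \<open>\<open>I = 0\<close> is excluded by the projective dimension of \<open>E\<^bsub>t+1\<^esub>\<close>\<close>
    have "\<exists>v0\<in>?K. \<phi>0 v0 \<noteq> 0"
    proof (rule ccontr)
      assume "\<not> (\<exists>v0\<in>?K. \<phi>0 v0 \<noteq> 0)"
      then have "{v \<in> ?K. \<phi>0 v = 0} = ?K" by blast
      then have surj: "f' ` supp_in ?Q = syz (Suc t)" using img by (simp only: syz_def)
      have t3: "t + 3 \<le> CARD('n)" using n t by linarith
      show False
        by (rule syz_no_short_resolution[OF homs(1) finite_atLeastAtMost inj homs(2)
            finite_atLeastAtMost ker surj t3])
    qed
    then obtain v0 where v0: "v0 \<in> ?K" "\<phi>0 v0 \<noteq> 0" by blast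
    have "card ?P + ((CARD('n) - 1) choose t) = card ?Q + 1"
      by (rule bourbaki_rank[OF homs(1) finite_atLeastAtMost inj homs(2) finite_atLeastAtMost
            ker \<phi>0 \<phi>0syz img v0])
    then show ?thesis by simp
  qed

  have diag: "res_diagram t p a q b \<beta>s"
    unfolding res_diagram_def Let_def
  proof (rule exI[where x = \<beta>], rule exI[where x = \<alpha>], intro conjI ballI)
    show "\<beta> (basis i) = \<beta>s i" if "i \<in> ?Q" for i
      using that by (simp add: \<beta>_def lin_ext_basis)
    have \<alpha>Q: "\<alpha> x \<in> supp_in ?Q" "f (\<alpha> x) = 0" if "x \<in> supp_in ?P" for x
      using exG that by blast+
    have \<alpha>surj: "\<exists>x\<in>supp_in ?P. g = \<alpha> x" if "g \<in> supp_in ?Q" "koszul_diff (\<beta> g) = 0" for g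
      using exG that d\<beta> by auto
    show "gmono ?F \<alpha> ?G" using \<alpha> \<alpha>ker by (simp add: gmono_def)
    show "giso (gsub ?F (gker ?F (\<lambda>u. \<beta> (\<alpha> u)))) \<alpha> (gsub ?G (gker ?G \<beta>))"
    proof -
      have "\<alpha> ` gker ?F (\<lambda>u. \<beta> (\<alpha> u)) = gker ?G \<beta>"
      proof
        show "gker ?G \<beta> \<subseteq> \<alpha> ` gker ?F (\<lambda>u. \<beta> (\<alpha> u))"
        proof
          fix g assume g: "g \<in> gker ?G \<beta>"
          then have g': "g \<in> supp_in ?Q" "\<beta> g = 0" by (auto simp: gker_def carr_free)
          then have "koszul_diff (\<beta> g) = 0" by (simp only: kd.zero)
          then obtain x where "x \<in> supp_in ?P" "g = \<alpha> x" using \<alpha>surj g'(1) by blast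
          then show "g \<in> \<alpha> ` gker ?F (\<lambda>u. \<beta> (\<alpha> u))"
            using g'(2) by (auto simp: gker_def carr_free)
        qed
      qed (use \<alpha>Q in \<open>auto simp: gker_def carr_free\<close>)
      moreover have "gker (gsub ?F (gker ?F (\<lambda>u. \<beta> (\<alpha> u)))) \<alpha> = {0}"
      proof -
        have 0: "0 \<in> gker ?F \<alpha>" using \<alpha>ker by simp
        then have "\<alpha> 0 = 0" by (simp add: gker_def)
        then have "\<beta> (\<alpha> 0) = 0" by (simp only: \<beta>.zero)
        then show ?thesis using \<alpha>ker 0 by (auto simp: gker_def)
      qed
      moreover have "ghom 0 (gsub ?F (gker ?F (\<lambda>u. \<beta> (\<alpha> u)))) (gsub ?G (gker ?G \<beta>)) \<alpha>"
        using \<alpha> calculation(1) by (auto simp: ghom_def gker_def)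
      ultimately show ?thesis by (simp add: giso_def gmono_def)
    qed
    have Bsub: "0 \<in> B \<inter> syz (t + 2)"
      using fam.subspace_0[OF subspace_syz] by (simp add: B_def fam.span_zero)
    then show "gmono (gsub (koszul (t + 1)) (fam.span (\<beta>s ` ?Q) \<inter> syz (t + 2))) (\<lambda>v. v)
       (gsub (koszul (t + 1)) (fam.span (\<beta>s ` ?Q)))"
      by (auto simp: gmono_def ghom_def gker_def B_def)
    have F0: "0 \<in> (supp_in ?P :: (nat \<Rightarrow> ('n, 'k) mpoly) set)"
      "0 \<in> (supp_in ?Q :: (nat \<Rightarrow> ('n, 'k) mpoly) set)"
      by (rule fam.subspace_0[OF subspace_supp_in])+
    have \<alpha>0: "\<alpha> 0 = 0" by (rule ghom_zero[OF \<alpha>]) (simp only: carr_free F0)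
    have Res: "ghom 0 ?F (koszul (Suc t)) (\<lambda>u. \<beta> (\<alpha> u))"
      using \<alpha> \<beta>hom by (auto simp: ghom_def image_subset_iff)
    have ResIm: "(\<lambda>u. \<beta> (\<alpha> u)) ` supp_in ?P = B \<inter> syz (Suc (Suc t))"
    proof
      show "(\<lambda>u. \<beta> (\<alpha> u)) ` supp_in ?P \<subseteq> B \<inter> syz (Suc (Suc t))"
        using \<alpha>Q by (auto simp: B d\<beta> intro!: koszul_exact \<beta>K)
      show "B \<inter> syz (Suc (Suc t)) \<subseteq> (\<lambda>u. \<beta> (\<alpha> u)) ` supp_in ?P"
      proof
        fix u assume u: "u \<in> B \<inter> syz (Suc (Suc t))"
        then obtain g where g: "g \<in> supp_in ?Q" "u = \<beta> g" unfolding B by blast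
        then have "koszul_diff (\<beta> g) = 0" using u koszul_diff_syz by blast
        then show "u \<in> (\<lambda>u. \<beta> (\<alpha> u)) ` supp_in ?P" using \<alpha>surj g by blast
      qed
    qed
    show "short_exact (gsub ?F (gker ?F (\<lambda>u. \<beta> (\<alpha> u)))) (\<lambda>u. u) ?F (\<lambda>u. \<beta> (\<alpha> u))
       (gsub (koszul (t + 1)) (fam.span (\<beta>s ` ?Q) \<inter> syz (t + 2)))"
      unfolding short_exact_def gmono_def
    proof (intro conjI)
      show "ghom 0 ?F (gsub (koszul (t + 1)) (fam.span (\<beta>s ` ?Q) \<inter> syz (t + 2))) (\<lambda>u. \<beta> (\<alpha> u))"
        unfolding B_def[symmetric] using Res ResIm by (auto simp: ghom_def carr_free hpart_free)
      show "(\<lambda>u. \<beta> (\<alpha> u)) ` carr ?F = carr (gsub (koszul (t + 1)) (fam.span (\<beta>s ` ?Q) \<inter> syz (t + 2)))"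
        using ResIm by (simp add: B_def carr_free)
      have "\<beta> (\<alpha> 0) = 0" by (simp only: \<alpha>0 \<beta>.zero)
      then show "gker (gsub ?F (gker ?F (\<lambda>u. \<beta> (\<alpha> u)))) (\<lambda>u. u) = {0}"
        using F0 by (auto simp: gker_def carr_free)
    qed (auto simp: ghom_def gker_def)
    show "short_exact (gsub ?G (gker ?G \<beta>)) (\<lambda>u. u) ?G \<beta> (gsub (koszul (t + 1)) (fam.span (\<beta>s ` ?Q)))"
      unfolding short_exact_def gmono_def
    proof (intro conjI)
      show "ghom 0 ?G (gsub (koszul (t + 1)) (fam.span (\<beta>s ` ?Q))) \<beta>"
        unfolding B_def[symmetric] using \<beta>hom B by (auto simp: ghom_def carr_free hpart_free)
      show "\<beta> ` carr ?G = carr (gsub (koszul (t + 1)) (fam.span (\<beta>s ` ?Q)))"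
        using B by (simp add: B_def carr_free)
      show "gker (gsub ?G (gker ?G \<beta>)) (\<lambda>u. u) = {0}"
        using F0 \<beta>.zero by (auto simp: gker_def carr_free)
    qed (auto simp: ghom_def gker_def)
  qed
  have "bourbaki_data t c p a q b \<beta>s \<phi>"
    unfolding bourbaki_data_def
    using \<beta>s_notin \<phi>A \<phi>hom \<phi>ker pq diag by (simp add: B_def)
  moreover have "I = \<phi> ` carr (koszul (t + 1))"
    using \<pi>im by (force simp: syz_def \<phi>\<pi>)
  ultimately show ?thesis by blast
qed

text \<open>
  Conversely \<open>f = \<partial> \<circ> \<beta>\<close>, and \<open>\<phi>\<close> vanishes on \<open>E\<^bsub>t+2\<^esub> = Ker \<partial>\<close>, hence induces \<open>\<pi>\<close> on \<open>E\<^bsub>t+1\<^esub>\<close>.  The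
  kernel of \<open>f\<close> is the preimage of \<open>E\<^bsub>t+2\<^esub>\<close> under \<open>\<beta>\<close>, and by the diagram every element of it differs
  from one of \<open>\<iota> F\<close> by an element of \<open>Ker \<beta> = \<iota> (Ker Res(\<beta>))\<close>.
\<close>

lemma bourbaki_data_imp_sequence:
  fixes \<beta>s :: "nat \<Rightarrow> 'n::{finite,linorder} set \<Rightarrow> ('n, 'k::field) mpoly"
  assumes bd: "bourbaki_data t c p a q b \<beta>s \<phi>"
  shows "\<exists>\<alpha> f \<pi>. long_bourbaki t c p a q b (\<phi> ` carr (koszul (t + 1))) \<alpha> f \<pi> \<and>
    (\<forall>i\<in>{1..q}. f (basis i) \<noteq> 0)"
proof -
  let ?K = "carr (koszul (Suc t)) :: ('n set \<Rightarrow> ('n, 'k) mpoly) set"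
  let ?P = "{1..p}" and ?Q = "{1..q}"
  let ?F = "free_gmod ?P a :: (('n, 'k) mpoly, _) gmod"
  let ?G = "free_gmod ?Q b :: (('n, 'k) mpoly, _) gmod"
  define I where "I = \<phi> ` ?K"
  define B where "B = fam.span (\<beta>s ` ?Q)"
  have \<beta>s: "\<beta>s i \<in> ?K" "\<beta>s i \<notin> syz (Suc (Suc t))" if "i \<in> ?Q" for i
    using bd that by (auto simp: bourbaki_data_def)
  have \<phi>: "ghom (int CARD('n) + c) (koszul (Suc t)) (shift (- int CARD('n)) ring_gmod) \<phi>"
    and \<phi>ker: "{v \<in> ?K. \<phi> v = 0} = {u + v | u v. u \<in> B \<and> v \<in> syz (Suc (Suc t))}"
    and diag: "res_diagram t p a q b \<beta>s"
    using bd by (auto simp: bourbaki_data_def B_def gker_def)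
  obtain \<beta> \<iota> where \<beta>b: "\<And>i. i \<in> ?Q \<Longrightarrow> \<beta> (basis i) = \<beta>s i"
    and \<iota>mono: "gmono ?F \<iota> ?G"
    and \<iota>ker: "\<iota> ` {u \<in> supp_in ?P. \<beta> (\<iota> u) = 0} = {g \<in> supp_in ?Q. \<beta> g = 0}"
    and ResIm: "(\<lambda>u. \<beta> (\<iota> u)) ` supp_in ?P = B \<inter> syz (Suc (Suc t))"
    and \<beta>: "ghom 0 ?G (gsub (koszul (Suc t)) B) \<beta>"
    and \<beta>im: "\<beta> ` supp_in ?Q = B"
    using diag unfolding res_diagram_def Let_def giso_def short_exact_def
    apply (elim exE conjE)
    subgoal premises prems for \<beta> \<iota>
      by (rule that[of \<beta> \<iota>]) (use prems in \<open>simp_all add: gker_def carr_free B_def\<close>)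
    done
  have BK: "B \<subseteq> ?K"
    unfolding B_def using \<beta>s(1) by (intro fam.span_minimal subspace_koszul) auto
  have \<beta>K: "\<beta> g \<in> ?K" if "g \<in> supp_in ?Q" for g
    using that BK \<beta>im by blast
  have \<beta>_add: "\<beta> (u + v) = \<beta> u + \<beta> v" if "u \<in> supp_in ?Q" "v \<in> supp_in ?Q" for u v
    using ghomD(2)[OF \<beta>] that by (simp only: carr_free)
  have \<iota>: "ghom 0 ?F ?G \<iota>" using \<iota>mono by (simp add: gmono_def)
  have \<iota>Q: "\<iota> x \<in> supp_in ?Q" if "x \<in> supp_in ?P" for x
    using ghomD(1)[OF \<iota>, of x] that by (simp add: carr_free)
  have \<phi>_add: "\<phi> (u + v) = \<phi> u + \<phi> v" if "u \<in> ?K" "v \<in> ?K" for u v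
    using ghomD(2)[OF \<phi>] that .
  have \<phi>_scale: "\<phi> (smult r u) = r * \<phi> u" if "u \<in> ?K" for r u
    using ghomD(3)[OF \<phi> that, of r] by simp
  have \<phi>syz: "\<phi> v = 0" if "v \<in> syz (Suc (Suc t))" for v
  proof -
    have "0 + v \<in> {v \<in> ?K. \<phi> v = 0}"
      unfolding \<phi>ker B_def using that fam.span_zero by blast
    then show ?thesis by simp
  qed

  define f where "f g = koszul_diff (\<beta> g)" for g
  \<comment> \<open>two preimages of \<open>u\<close> differ by an element of \<open>E\<^bsub>t+2\<^esub>\<close>, which \<open>\<phi>\<close> does not see\<close>
  define \<pi> where "\<pi> u = \<phi> (SOME v. v \<in> ?K \<and> koszul_diff v = u)" for u
  have \<pi>: "\<pi> (koszul_diff v) = \<phi> v" if v: "v \<in> ?K" for v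
  proof -
    define w where "w = (SOME w. w \<in> ?K \<and> koszul_diff w = koszul_diff v)"
    have w: "w \<in> ?K" "koszul_diff w = koszul_diff v"
      using someI[of "\<lambda>w. w \<in> ?K \<and> koszul_diff w = koszul_diff v" v] v by (auto simp: w_def)
    have wv: "w - v \<in> syz (Suc (Suc t))"
      by (rule koszul_exact) (auto simp: fam.subspace_diff[OF subspace_koszul] v w kd.diff)
    have "\<phi> w = \<phi> (v + (w - v))" by simp
    also have "\<dots> = \<phi> v + \<phi> (w - v)" by (intro \<phi>_add v syz_carr wv)
    also have "\<dots> = \<phi> v" by (simp only: \<phi>syz[OF wv]) simp
    finally show ?thesis by (simp only: \<pi>_def w_def)
  qed
  have f: "ghom 0 ?G (syz_gmod (Suc t)) f"
    unfolding ghom_def syz_gmod_Suc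
  proof (intro conjI allI ballI)
    show "f ` carr ?G \<subseteq> carr (gsub (koszul t) (syz (Suc t)))"
      using \<beta>K by (auto simp: f_def syz_def carr_free)
    show "f (u + v) = f u + f v" if "u \<in> carr ?G" "v \<in> carr ?G" for u v
      using that by (simp only: f_def \<beta>_add kd.add carr_free)
    show "f (act ?G r u) = act (gsub (koszul t) (syz (Suc t))) r (f u)" if "u \<in> carr ?G" for r u
      using ghomD(3)[OF \<beta> that, of r] by (simp add: f_def kd.scale)
    show "f u \<in> hpart (gsub (koszul t) (syz (Suc t))) (i + 0)" if "u \<in> hpart ?G i" for i u
      using ghomD(4)[OF \<beta> that] BK
      by (auto simp: f_def syz_def intro: koszul_diff_hpart)
  qed
  have \<pi>hom: "ghom 0 (syz_gmod (Suc t)) (shift c (gsub ring_gmod I)) \<pi>"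
    unfolding ghom_def syz_gmod_Suc
  proof (intro conjI allI ballI)
    show "\<pi> ` carr (gsub (koszul t) (syz (Suc t))) \<subseteq> carr (shift c (gsub ring_gmod I))"
      by (auto simp: syz_def \<pi> I_def)
    show "\<pi> (u + v) = \<pi> u + \<pi> v"
      if u: "u \<in> carr (gsub (koszul t) (syz (Suc t)))" and v: "v \<in> carr (gsub (koszul t) (syz (Suc t)))"
      for u v
    proof -
      obtain u' where "u' \<in> ?K" "u = koszul_diff u'"
        using u by (auto simp: syz_def)
      moreover obtain v' where "v' \<in> ?K" "v = koszul_diff v'"
        using v by (auto simp: syz_def)
      ultimately show ?thesis
        by (simp only: kd.add[symmetric] \<pi> \<phi>_add fam.subspace_add[OF subspace_koszul])
    qed
    show "\<pi> (act (gsub (koszul t) (syz (Suc t))) r u) = act (shift c (gsub ring_gmod I)) r (\<pi> u)"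
      if u: "u \<in> carr (gsub (koszul t) (syz (Suc t)))" for r u
    proof -
      obtain u' where "u' \<in> ?K" "u = koszul_diff u'"
        using u by (auto simp: syz_def)
      then show ?thesis
        by (simp add: kd.scale[symmetric] \<pi> \<phi>_scale fam.subspace_scale[OF subspace_koszul])
    qed
    show "\<pi> u \<in> hpart (shift c (gsub ring_gmod I)) (i + 0)"
      if u: "u \<in> hpart (gsub (koszul t) (syz (Suc t))) i" for i u
    proof -
      obtain v where v: "v \<in> hpart (koszul (Suc t)) i" "koszul_diff v = u"
        by (rule syz_lift_homogeneous[of u t i]) (use u in simp_all)
      then have "v \<in> ?K" by (simp add: hpart_koszul)
      then show ?thesis
        using ghomD(4)[OF \<phi> v(1)] by (auto simp: \<pi> I_def add.commute simp flip: v(2))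
    qed
  qed
  have exG: "\<iota> ` supp_in ?P = {g \<in> supp_in ?Q. f g = 0}"
  proof
    show "\<iota> ` supp_in ?P \<subseteq> {g \<in> supp_in ?Q. f g = 0}"
      using \<iota>Q ResIm koszul_diff_syz by (fastforce simp: f_def)
    show "{g \<in> supp_in ?Q. f g = 0} \<subseteq> \<iota> ` supp_in ?P"
    proof
      fix g assume "g \<in> {g \<in> supp_in ?Q. f g = 0}"
      then have g: "g \<in> supp_in ?Q" "koszul_diff (\<beta> g) = 0" by (auto simp: f_def)
      then have "\<beta> g \<in> B \<inter> syz (Suc (Suc t))"
        using \<beta>im koszul_exact[OF \<beta>K] by blast
      then obtain x where x: "x \<in> supp_in ?P" "\<beta> (\<iota> x) = \<beta> g"
        unfolding ResIm[symmetric] by force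
      have d: "g - \<iota> x \<in> supp_in ?Q"
        by (intro fam.subspace_diff[OF subspace_supp_in] g \<iota>Q x)
      have "\<beta> ((g - \<iota> x) + \<iota> x) = \<beta> (g - \<iota> x) + \<beta> (\<iota> x)"
        by (rule \<beta>_add[OF d \<iota>Q[OF x(1)]])
      then have "\<beta> (g - \<iota> x) = 0" by (simp add: x(2))
      then have "g - \<iota> x \<in> \<iota> ` {u \<in> supp_in ?P. \<beta> (\<iota> u) = 0}"
        unfolding \<iota>ker using d by simp
      then obtain y where y: "y \<in> supp_in ?P" "g - \<iota> x = \<iota> y" by blast
      have "\<iota> (y + x) = \<iota> y + \<iota> x"
        using ghomD(2)[OF \<iota>] y(1) x(1) by (simp only: carr_free)
      also have "\<dots> = g" by (simp flip: y(2))
      finally show "g \<in> \<iota> ` supp_in ?P"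
        using fam.subspace_add[OF subspace_supp_in y(1) x(1)] by blast
    qed
  qed
  have exE: "f ` supp_in ?Q = {u \<in> syz (Suc t). \<pi> u = 0}"
  proof
    have "\<phi> v = 0" if "v \<in> B" for v
    proof -
      have "v + 0 \<in> {v \<in> ?K. \<phi> v = 0}"
        unfolding \<phi>ker using that fam.subspace_0[OF subspace_syz] by blast
      then show ?thesis by simp
    qed
    then show "f ` supp_in ?Q \<subseteq> {u \<in> syz (Suc t). \<pi> u = 0}"
      using \<beta>K \<beta>im by (auto simp: f_def syz_def \<pi>)
    show "{u \<in> syz (Suc t). \<pi> u = 0} \<subseteq> f ` supp_in ?Q"
    proof
      fix u assume "u \<in> {u \<in> syz (Suc t). \<pi> u = 0}"
      then obtain v where v: "v \<in> ?K" "u = koszul_diff v" "\<phi> v = 0" by (auto simp: syz_def \<pi>)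
      then have "v \<in> {v \<in> ?K. \<phi> v = 0}" by simp
      then obtain w z where wz: "v = w + z" "w \<in> B" "z \<in> syz (Suc (Suc t))"
        unfolding \<phi>ker by blast
      then obtain g where g: "g \<in> supp_in ?Q" "w = \<beta> g" using \<beta>im by blast
      have "u = f g"
        by (simp only: v(2) wz(1) kd.add koszul_diff_syz[OF wz(3)] f_def g(2)) simp
      then show "u \<in> f ` supp_in ?Q" using g(1) by blast
    qed
  qed
  have \<pi>im: "\<pi> ` syz (Suc t) = I"
    unfolding syz_def I_def image_image by (rule image_cong) (simp_all add: \<pi>)
  have subI: "module.subspace (*) I"
  proof (rule module.subspaceI[OF module_times])
    show "0 \<in> I"
      unfolding I_def
      using \<phi>syz[OF fam.subspace_0[OF subspace_syz]] fam.subspace_0[OF subspace_koszul]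
      by (metis image_eqI)
    show "x + y \<in> I" if "x \<in> I" "y \<in> I" for x y
      using that unfolding I_def
      by (auto simp: \<phi>_add[symmetric] fam.subspace_add[OF subspace_koszul] simp del: plus_fun_apply)
    show "r * x \<in> I" if "x \<in> I" for r x
      using that unfolding I_def
      by (auto simp: \<phi>_scale[symmetric] fam.subspace_scale[OF subspace_koszul])
  qed
  have "I = module.span (*) {h \<in> I. \<exists>d. h \<in> homog d}"
  proof
    show "module.span (*) {h \<in> I. \<exists>d. h \<in> homog d} \<subseteq> I"
      by (rule module.span_minimal[OF module_times _ subI]) blast
    show "I \<subseteq> module.span (*) {h \<in> I. \<exists>d. h \<in> homog d}"
    proof
      fix h assume "h \<in> I"
      then obtain v where v: "v \<in> ?K" "h = \<phi> v" by (auto simp: I_def)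
      have "\<phi> v = (\<Sum>J | card J = Suc t. v J * \<phi> (basis J))"
        using ghom_free_expand[OF \<phi>[unfolded koszul_def]] v(1) by (simp add: carr_koszul_supp_in)
      moreover have "v J * \<phi> (basis J) \<in> module.span (*) {h \<in> I. \<exists>d. h \<in> homog d}"
        if "J \<in> {J. card J = Suc t}" for J
      proof (intro module.span_scale[OF module_times] module.span_base[OF module_times])
        have "basis J \<in> hpart (koszul (Suc t)) (int (Suc t))"
          using basis_hpart[OF that] by (simp only: koszul_def)
        from ghomD(4)[OF \<phi> this] show "\<phi> (basis J) \<in> {h \<in> I. \<exists>d. h \<in> homog d}"
          using that by (auto simp: I_def intro: basis_koszul)
      qed
      ultimately show "h \<in> module.span (*) {h \<in> I. \<exists>d. h \<in> homog d}"
        unfolding v(2) by (simp only: module.span_sum[OF module_times])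
    qed
  qed
  then have "graded_ideal I" using subI by (simp add: graded_ideal_def)
  then have "long_bourbaki t c p a q b I \<iota> f \<pi>"
    unfolding long_bourbaki_def exact4_def
    using \<iota>mono f \<pi>hom exG exE \<pi>im by (simp add: gker_def carr_free syz_gmod_Suc)
  moreover have "\<forall>i\<in>?Q. f (basis i) \<noteq> 0"
    using \<beta>s \<beta>b koszul_exact unfolding f_def by metis
  ultimately show ?thesis unfolding I_def by auto
qed

theorem theorem2p3:
  fixes t p q :: nat and c :: int and a b :: "nat \<Rightarrow> int"
  assumes "CARD('n::{finite,linorder}) \<ge> 4" and "t \<le> CARD('n) - 4"
  shows
    "((\<exists>(I :: ('n::{finite,linorder}, 'k::field) mpoly set) \<alpha> f \<pi>.
          long_bourbaki t c p a q b I \<alpha> f \<pi> \<and> (\<forall>i\<in>{1..q}. f (basis i) \<noteq> 0))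
      \<longleftrightarrow>
      (\<exists>(\<beta>s :: nat \<Rightarrow> 'n set \<Rightarrow> ('n, 'k) mpoly) \<phi>. bourbaki_data t c p a q b \<beta>s \<phi>))
     \<and>
     (\<forall>(I :: ('n, 'k) mpoly set) \<alpha> f \<pi>.
        long_bourbaki t c p a q b I \<alpha> f \<pi> \<and> (\<forall>i\<in>{1..q}. f (basis i) \<noteq> 0) \<longrightarrow>
        (\<exists>\<beta>s \<phi>. bourbaki_data t c p a q b \<beta>s \<phi> \<and>
           gsub ring_gmod I = shift (- c) (gsub (shift c ring_gmod) (\<phi> ` carr (koszul (t + 1))))))
     \<and>
     (\<forall>(\<beta>s :: nat \<Rightarrow> 'n set \<Rightarrow> ('n, 'k) mpoly) \<phi>.
        bourbaki_data t c p a q b \<beta>s \<phi> \<longrightarrow>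
        (\<exists>I \<alpha> f \<pi>.
           long_bourbaki t c p a q b I \<alpha> f \<pi> \<and> (\<forall>i\<in>{1..q}. f (basis i) \<noteq> 0) \<and>
           gsub ring_gmod I = shift (- c) (gsub (shift c ring_gmod) (\<phi> ` carr (koszul (t + 1))))))"
proof -
  have forward: "\<exists>\<beta>s \<phi>. bourbaki_data t c p a q b \<beta>s \<phi> \<and>
      gsub ring_gmod I = shift (- c) (gsub (shift c ring_gmod) (\<phi> ` carr (koszul (t + 1))))"
    if "long_bourbaki t c p a q b I \<alpha> f \<pi>" "\<forall>i\<in>{1..q}. f (basis i) \<noteq> 0"
    for I :: "('n, 'k) mpoly set" and \<alpha> f \<pi>
    using bourbaki_sequence_imp_data[OF assms that] gsub_shift_eq by metis
  have backward: "\<exists>I \<alpha> f \<pi>.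
      long_bourbaki t c p a q b I \<alpha> f \<pi> \<and> (\<forall>i\<in>{1..q}. f (basis i) \<noteq> 0) \<and>
      gsub ring_gmod I = shift (- c) (gsub (shift c ring_gmod) (\<phi> ` carr (koszul (t + 1))))"
    if "bourbaki_data t c p a q b \<beta>s \<phi>"
    for \<beta>s :: "nat \<Rightarrow> 'n set \<Rightarrow> ('n, 'k) mpoly" and \<phi>
    using bourbaki_data_imp_sequence[OF that] gsub_shift_eq by blast
  show ?thesis
    using forward backward by (intro conjI iffI allI impI) blast+
qed

end
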